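(* Let $(\nu,x_0)\in\Omega$ with $(\nu,x_0)\neq(2,0)$ and $(\nu,x_0)\neq(2,1)$. Then the $\mathrm{JR}$-number of $K^{\nu,x_0}$ either equals $4$ and is not a minimum, or lies strictly between $4$ and $+\infty$.
   Context: For integers $\nu\ge2$ and $x_0\ge0$, define $x_{n+1}=\pm\sqrt{\nu+x_n}$ for $n\ge0$ (any choice of sign at each step), $K^{\nu,x_0}_n=\mathbb{Q}(x_n)$ and $K^{\nu,x_0}=\bigcup_{n\ge0}K^{\nu,x_0}_n$. $\Omega$ is the set of pairs $(\nu,x_0)$ such that $[K^{\nu,x_0}_{n+1}:K^{\nu,x_0}_n]=2$ for every $n\ge0$ and $K^{\nu,x_0}$ is totally real. For a ring $R$ of totally real algebraic integers and $t\in\mathbb{R}\cup\{+\infty\}$, let $\mathcal{O}_t=\{x\in R:\text{all conjugates of }x\text{ lie in }(0,t)\}$; the $\mathrm{JR}$-number of $R$ is the infimum of the set of $t$ such that $\mathcal{O}_t$ is infinite, and it is a minimum if it belongs to that set. The $\mathrm{JR}$-number of a totally real field is the $\mathrm{JR}$-number of its ring of integers. *)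

theory Defs
  imports
    "HOL-Algebra.Generated_Fields"
    "HOL-Algebra.Embedded_Algebras"
    "HOL-Algebra.Algebraic_Closure_Type"
    "HOL-Library.Extended_Real"
    Complex_Main
begin

abbreviation complex_field :: "complex ring" where
  "complex_field \<equiv> ring_of_type_algebra"

definition totally_real_field :: "complex set \<Rightarrow> bool" where
  "totally_real_field K \<longleftrightarrow>
     (\<forall>\<sigma> \<in> ring_hom (complex_field\<lparr>carrier := K\<rparr>) complex_field. \<sigma> ` K \<subseteq> \<real>)"

text \<open>Conjugates over the rationals: the roots of an irreducible rational polynomial
  that vanishes at \<open>a\<close>. The set is empty if \<open>a\<close> is transcendental.\<close>

definition conjugates :: "complex \<Rightarrow> complex set" where
  "conjugates a = {b. \<exists>p :: rat poly. Factorial_Ring.irreducible p \<and>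
     poly (map_poly of_rat p) a = 0 \<and> poly (map_poly of_rat p) b = 0}"

definition ring_of_integers :: "complex set \<Rightarrow> complex set" where
  "ring_of_integers K = {a \<in> K. algebraic_int a}"


definition conj_in_interval :: "complex set \<Rightarrow> ereal \<Rightarrow> complex set" where
  "conj_in_interval R t =
     {a \<in> R. \<forall>b \<in> conjugates a. b \<in> \<real> \<and> 0 < Re b \<and> ereal (Re b) < t}"

definition JR_set :: "complex set \<Rightarrow> ereal set" where
  "JR_set R = {t. t \<noteq> -\<infinity> \<and> infinite (conj_in_interval R t)}"

definition JR_number :: "complex set \<Rightarrow> ereal" where
  "JR_number R = Inf (JR_set R)"

definition JR_is_minimum :: "complex set \<Rightarrow> bool" where
  "JR_is_minimum R \<longleftrightarrow> JR_number R \<in> JR_set R"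


definition sqrt_seq :: "nat \<Rightarrow> nat \<Rightarrow> (nat \<Rightarrow> complex) \<Rightarrow> bool" where
  "sqrt_seq \<nu> x0 x \<longleftrightarrow> x 0 = of_nat x0 \<and>
     (\<forall>n. x (Suc n) = csqrt (of_nat \<nu> + x n) \<or> x (Suc n) = - csqrt (of_nat \<nu> + x n))"

text \<open>The subfield generated by \<open>x n\<close>; it contains the rationals since the characteristic is 0.\<close>

definition tower_field :: "(nat \<Rightarrow> complex) \<Rightarrow> nat \<Rightarrow> complex set" where
  "tower_field x n = generate_field complex_field {x n}"

definition tower_union :: "(nat \<Rightarrow> complex) \<Rightarrow> complex set" where
  "tower_union x = (\<Union>n. tower_field x n)"

text \<open>Whether the two conditions below hold does not depend on the signs in \<open>x\<close>: once all the
  degrees are 2 for one choice of signs, \<open>x n\<close> has degree \<open>2 ^ n\<close> over the rationals, and the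
  values of \<open>x n\<close> for the other choices are its conjugates.\<close>

definition Omega :: "(nat \<times> nat) set" where
  "Omega = {(\<nu>, x0). 2 \<le> \<nu> \<and> (\<exists>x. sqrt_seq \<nu> x0 x \<and>
     (\<forall>n. ring.dimension complex_field 2 (tower_field x n) (tower_field x (Suc n))) \<and>
     totally_real_field (tower_union x))}"

end

theory Submission
  imports Defs
begin

text \<open>
  If all conjugates of an algebraic integer \<open>\<alpha>\<close> lie in \<open>(0, 4)\<close>, then by Kronecker
  \<open>\<alpha> - 2 = w + w\<^sup>-\<^sup>1\<close> for a root of unity \<open>w\<close>, so \<open>\<rat>(\<alpha>)\<close> is normal. Suppose such an \<open>\<alpha>\<close> lies in \<open>K\<^sub>n\<^sub>+\<^sub>1\<close>
  but not in \<open>K\<^sub>n\<close>. Comparing \<open>\<alpha>\<close> with its conjugates shows that \<open>K\<^sub>n\<^sub>+\<^sub>1 = K\<^sub>n(\<surd>(\<nu> + x\<^sub>n))\<close> also contains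
  \<open>\<surd>(\<nu> - x\<^sub>n)\<close>. Hence \<open>\<nu>\<^sup>2 - \<nu> - x\<^sub>m\<close> or \<open>(\<nu>\<^sup>2 - \<nu> - x\<^sub>m) (\<nu> + x\<^sub>m)\<close> is a square in \<open>K\<^sub>m\<close>, where \<open>m = n - 1\<close>, and
  taking norms down to \<open>\<rat>\<close>, \<open>a\<^sub>m\<^sub>+\<^sub>2 - x\<^sub>0\<close> or \<open>(a\<^sub>m\<^sub>+\<^sub>2 - x\<^sub>0) (a\<^sub>m\<^sub>+\<^sub>1 - x\<^sub>0)\<close> is a square of an integer, where \<open>a\<^sub>k\<close> is
  the \<open>k\<close>-th iterate of \<open>z\<^sup>2 - \<nu>\<close> at 0. For \<open>\<nu> \<ge> 3\<close> Runge's method excludes this for large \<open>m\<close>; so these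
  \<open>\<alpha>\<close> lie in a fixed \<open>K\<^sub>N\<close> and are finite in number, and 4 is not in the set whose infimum is taken.
  The remaining pairs with \<open>\<nu> = 2\<close> are not in \<open>\<Omega>\<close>. The integers \<open>x\<^sub>n + c\<close> bound the infimum.
\<close>

subsection \<open>Evaluation of rational and integer polynomials\<close>

text \<open>Rational polynomials serve for fields and conjugates, integer polynomials for algebraic
  integers; both are evaluated by the same rules.\<close>

locale eval_hom =
  fixes h :: "'a::comm_ring_1 \<Rightarrow> complex"
  assumes hom_0: "h 0 = 0" and hom_1: "h 1 = 1"
    and hom_add: "h (a + b) = h a + h b" and hom_mult: "h (a * b) = h a * h b"
begin

lemma hom_uminus: "h (- a) = - h a"
  using hom_add[of a "- a"] by (simp add: hom_0 eq_neg_iff_add_eq_0 add.commute)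

abbreviation ev :: "'a poly \<Rightarrow> complex \<Rightarrow> complex" where
  "ev p z \<equiv> poly (map_poly h p) z"

lemma ev_0: "ev 0 z = 0" by simp

lemma ev_pCons: "ev (pCons a p) z = h a + z * ev p z"
  by (simp add: map_poly_pCons hom_0)

lemma ev_1: "ev 1 z = 1"
  by (simp add: one_pCons map_poly_pCons hom_0 hom_1)

lemma ev_add: "ev (p + q) z = ev p z + ev q z"
  by (induction p q rule: poly_induct2)
    (auto simp: ev_pCons ev_0 hom_add algebra_simps simp del: map_poly_pCons)

lemma ev_smult: "ev (smult c p) z = h c * ev p z"
  by (induction p) (auto simp: ev_pCons ev_0 hom_mult algebra_simps simp del: map_poly_pCons)

lemma ev_mult: "ev (p * q) z = ev p z * ev q z"
  by (induction p) (auto simp: ev_pCons ev_0 ev_add ev_smult hom_0 algebra_simps simp del: map_poly_pCons)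

lemma ev_uminus: "ev (- p) z = - ev p z"
  by (induction p) (auto simp: ev_pCons ev_0 hom_uminus algebra_simps simp del: map_poly_pCons)

lemma ev_diff: "ev (p - q) z = ev p z - ev q z"
  using ev_add[of p "- q" z] by (simp add: ev_uminus)

lemma ev_power: "ev (p ^ n) z = ev p z ^ n"
  by (induction n) (auto simp: ev_1 ev_mult)

lemma ev_pcompose: "ev (p \<circ>\<^sub>p q) z = ev p (ev q z)"
  by (induction p) (auto simp: pcompose_pCons ev_pCons ev_add ev_mult ev_0 hom_0 simp del: map_poly_pCons)

lemma ev_monom: "ev (monom c n) z = h c * z ^ n"
  by (induction n) (auto simp: monom_Suc monom_0 ev_pCons hom_0 simp del: map_poly_pCons)

lemma ev_sum: "ev (\<Sum>i\<in>A. f i) z = (\<Sum>i\<in>A. ev (f i) z)"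
  by (induction A rule: infinite_finite_induct) (auto simp: ev_add)

lemmas ev_simps = ev_0 ev_pCons ev_1 ev_add ev_smult ev_mult ev_uminus ev_diff ev_power ev_pcompose
  hom_0 hom_1 hom_uminus

end

interpretation rat: eval_hom "of_rat :: rat \<Rightarrow> complex"
  by standard (auto simp: of_rat_add of_rat_mult)

interpretation int: eval_hom "of_int :: int \<Rightarrow> complex"
  by standard auto

abbreviation ev :: "rat poly \<Rightarrow> complex \<Rightarrow> complex" where
  "ev p z \<equiv> poly (map_poly of_rat p) z"

abbreviation evi :: "int poly \<Rightarrow> complex \<Rightarrow> complex" where
  "evi p z \<equiv> poly (map_poly of_int p) z"

declare map_poly_pCons [simp del]
declare rat.ev_simps [simp] int.ev_simps [simp]

text \<open>With \<open>c\<close> = \<nu> and argument \<open>x (Suc n)\<close> the inner polynomial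
  takes the value \<open>x n\<close>, so a polynomial in \<open>x (Suc n)\<close> splits into two
  coordinates over the field of \<open>x n\<close>.\<close>

lemma even_odd_decomposition:
  fixes p :: "'a::comm_ring_1 poly"
  obtains A B where "p = A \<circ>\<^sub>p [:- c, 0, 1:] + [:0, 1:] * (B \<circ>\<^sub>p [:- c, 0, 1:])"
proof -
  have "\<exists>A B. p = A \<circ>\<^sub>p [:- c, 0, 1:] + [:0, 1:] * (B \<circ>\<^sub>p [:- c, 0, 1:])"
  proof (induction p)
    case 0
    show ?case by (rule exI[of _ 0], rule exI[of _ 0]) simp
  next
    case (pCons a p)
    then obtain A B where *: "p = A \<circ>\<^sub>p [:- c, 0, 1:] + [:0, 1:] * (B \<circ>\<^sub>p [:- c, 0, 1:])" by blast
    have "[:c, 1:] \<circ>\<^sub>p [:- c, 0, 1:] = ([:0, 0, 1:] :: 'a poly)"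
      by (simp add: pcompose_pCons)
    moreover have "[:0, 1:] * [:0, 1:] = ([:0, 0, 1:] :: 'a poly)" by simp
    \<comment> \<open>X^2 is X + c composed with X^2 - c, so multiplication by X exchanges the roles
      of \<open>A\<close> and \<open>B\<close>.\<close>
    ultimately have sq: "[:c, 1:] \<circ>\<^sub>p [:- c, 0, 1:] = ([:0, 1:] * [:0, 1:] :: 'a poly)" by simp
    have "pCons a p = [:a:] + [:0, 1:] * p" by simp
    also have "\<dots> = ([:a:] + [:c, 1:] * B) \<circ>\<^sub>p [:- c, 0, 1:] + [:0, 1:] * (A \<circ>\<^sub>p [:- c, 0, 1:])"
      unfolding pcompose_add pcompose_mult sq by (subst *) (simp only: pcompose_const algebra_simps)
    finally show ?case by blast
  qed
  then show ?thesis using that by blast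
qed

lemma ev_of_nat: "ev p (of_nat k) = of_rat (poly p (of_nat k))"
  by (induction p) (auto simp: of_rat_add of_rat_mult)

lemma ev_even_odd_decomposition:
  obtains A B where "\<And>z. ev p z = ev A (z\<^sup>2 - of_nat c) + z * ev B (z\<^sup>2 - of_nat c)"
proof -
  obtain A B where "p = A \<circ>\<^sub>p [:- of_nat c, 0, 1:] + [:0, 1:] * (B \<circ>\<^sub>p [:- of_nat c, 0, 1:])"
    by (rule even_odd_decomposition)
  then have "ev p z = ev A (z\<^sup>2 - of_nat c) + z * ev B (z\<^sup>2 - of_nat c)" for z
    by (simp add: power2_eq_square)
  then show ?thesis using that by blast
qed

section \<open>Irreducible rational polynomials and minimal polynomials of algebraic
  integers\<close>

lemma irreducible_dvd_if_common_root:
  assumes "Factorial_Ring.irreducible (p :: rat poly)" "ev p a = 0" "ev q a = 0"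
  shows "p dvd q"
proof (rule ccontr)
  assume "\<not> p dvd q"
  then have "coprime p q" using assms(1) by (simp add: prime_elem_imp_coprime irreducible_imp_prime_elem)
  then obtain r s where "r * p + s * q = 1" by (metis bezout_coefficients_fst_snd coprime_imp_gcd_eq_1)
  then have "ev (r * p + s * q) a = 1" by simp
  then show False using assms by simp
qed

lemma conjugates_imp_root:
  assumes "b \<in> conjugates a" "ev q a = 0"
  shows "ev q b = 0"
proof -
  obtain p where p: "Factorial_Ring.irreducible p" "ev p a = 0" "ev p b = 0"
    using assms(1) by (auto simp: conjugates_def)
  have "p dvd q" using irreducible_dvd_if_common_root[OF p(1,2) assms(2)] .
  then show ?thesis using p by (auto elim!: dvdE)
qed

text \<open>A prime of \<open>\<int>[X]\<close> stays irreducible over \<open>\<rat>\<close>: clear the denominators of a factorisation.\<close>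

lemma algebraic_int_minpoly:
  assumes "algebraic_int (a :: complex)"
  obtains q :: "int poly" where "lead_coeff q = 1" "evi q a = 0"
    "Factorial_Ring.irreducible (map_poly of_int q :: rat poly)"
proof -
  have cd: "\<exists>(c::int) P. c \<noteq> 0 \<and> smult (of_int c) p = (map_poly of_int P :: rat poly)" for p :: "rat poly"
  proof (induction p)
    case 0
    show ?case by (rule exI[of _ 1]) (auto intro: exI[of _ 0])
  next
    case (pCons r p)
    then obtain c P where c: "c \<noteq> 0" "smult (of_int c) p = (map_poly of_int P :: rat poly)" by blast
    obtain m n where q: "quotient_of r = (m, n)" by (cases "quotient_of r")
    have n: "n > 0" using q quotient_of_denom_pos by blast
    have r: "of_int n * r = of_int m" using quotient_of_div[OF q] n by simp
    have "smult (of_int (c * n)) (pCons r p) = pCons (of_int (c * m)) (smult (of_int n) (smult (of_int c) p))"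
      using r by (simp add: mult_ac)
    also have "smult (of_int n) (smult (of_int c) p) = map_poly of_int (smult n P)"
      unfolding c(2) by (rule poly_eqI) (simp add: coeff_map_poly)
    also have "pCons (of_int (c * m)) \<dots> = (map_poly of_int (pCons (c * m) (smult n P)) :: rat poly)"
      by (simp add: map_poly_pCons)
    finally show ?case using c(1) n by (intro exI[of _ "c * n"]) auto
  qed
  obtain P :: "int poly" where P: "evi P a = 0" "lead_coeff P = 1"
    using assms by (auto simp: algebraic_int_altdef_ipoly)
  have P0: "P \<noteq> 0" using P(2) by auto
  \<comment> \<open>The factorisation recovers \<open>P\<close> only up to a unit \<open>u\<close>;
    a unit does not vanish at \<open>a\<close>, so some prime factor does.\<close>
  obtain u where u: "P = u * prod_mset (prime_factorization P)" "u dvd 1"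
    using prod_mset_prime_factorization_weak[OF P0]
    by (metis normalize_mult_unit_factor P0 associated_iff_dvd dvdE dvd_mult_cancel_left associatedE1 mult.commute)
  have root: "evi (prod_mset M) a = 0 \<Longrightarrow> \<exists>q\<in>#M. evi q a = 0" for M
    by (induction M) auto
  obtain v where v: "1 = u * v" using u(2) by (auto elim: dvdE)
  then have "evi u a * evi v a = 1" using int.ev_mult[of u v a] by (simp flip: v)
  then have "evi u a \<noteq> 0" by auto
  then have "evi (prod_mset (prime_factorization P)) a = 0" using P(1) u(1) by (metis int.ev_mult mult_eq_0_iff)
  then obtain q where q: "q \<in># prime_factorization P" "evi q a = 0" using root by blast
  have pr: "prime_elem q" and "q dvd P" using q(1) by (auto simp: in_prime_factors_iff)
  then obtain r where r: "P = q * r" by (auto elim: dvdE)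
  then have lc: "lead_coeff q * lead_coeff r = 1" using P(2) by (simp add: lead_coeff_mult)
  then have lq: "lead_coeff q = 1 \<or> lead_coeff q = -1" by (metis zmult_eq_1_iff)
  have degq: "degree q \<noteq> 0"
  proof
    assume "degree q = 0"
    then obtain k where k: "q = [:k:]" by (auto elim: degree_eq_zeroE)
    then show False using q(2) lq by auto
  qed
  have irr: "Factorial_Ring.irreducible (map_poly of_int q :: rat poly)"
  proof (rule irreducibleI)
    show "map_poly of_int q \<noteq> (0 :: rat poly)" using degq
      by (metis degree_0 degree_map_poly of_int_eq_0_iff)
    show "\<not> (map_poly of_int q :: rat poly) dvd 1"
      using degq by (auto simp: is_unit_poly_iff degree_map_poly dest!: arg_cong[of _ _ degree])
    fix f g :: "rat poly"
    assume fg: "map_poly of_int q = f * g"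
    obtain c F where F: "c \<noteq> 0" "smult (of_int c) f = (map_poly of_int F :: rat poly)" using cd by blast
    obtain d G where G: "d \<noteq> 0" "smult (of_int d) g = (map_poly of_int G :: rat poly)" using cd by blast
    have fg0: "f \<noteq> 0" "g \<noteq> 0" using fg degq by (metis degree_0 degree_map_poly mult_zero_left mult_zero_right of_int_eq_0_iff)+
    have FG0: "F \<noteq> 0" "G \<noteq> 0" using F G fg0 by auto
    have dF: "degree F = degree f"
      using arg_cong[OF F(2), of degree] F(1) by (simp add: degree_map_poly)
    have dG: "degree G = degree g"
      using arg_cong[OF G(2), of degree] G(1) by (simp add: degree_map_poly)
    have hm: "map_poly of_int (A * B) = (map_poly of_int A * map_poly of_int B :: rat poly)" for A B :: "int poly"
      by (rule poly_eqI) (simp add: coeff_map_poly coeff_mult)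
    have "map_poly of_int (F * G) = smult (of_int (c * d)) (f * g)"
      unfolding hm F(2)[symmetric] G(2)[symmetric] by (simp add: mult.commute)
    also have "\<dots> = (map_poly of_int (smult (c * d) q) :: rat poly)"
      unfolding fg[symmetric] by (rule poly_eqI) (simp add: coeff_map_poly)
    finally have "F * G = smult (c * d) q"
      by (metis (no_types, lifting) coeff_map_poly of_int_0 of_int_eq_iff poly_eqI)
    \<comment> \<open>The prime \<open>q\<close> divides one cleared factor, which then has at least
      the degree of \<open>q\<close>; the other factor is constant.\<close>
    then have "q dvd F * G" by (simp add: dvd_smult)
    then have "q dvd F \<or> q dvd G" using pr by (simp add: prime_elem_dvd_mult_iff)
    then have "degree q \<le> degree f \<or> degree q \<le> degree g"
      using dvd_imp_degree_le FG0 dF dG by metis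
    moreover have "degree q = degree f + degree g"
      using arg_cong[OF fg, of degree] fg0 by (simp add: degree_map_poly degree_mult_eq)
    ultimately have "degree g = 0 \<or> degree f = 0" by auto
    then show "f dvd 1 \<or> g dvd 1" using fg0 is_unit_iff_degree by metis
  qed
  have neg: "map_poly of_int (- q) = - (map_poly of_int q :: rat poly)"
    by (rule poly_eqI) (simp add: coeff_map_poly)
  show ?thesis
  proof (cases "lead_coeff q = 1")
    case True
    then show ?thesis using that irr q(2) by blast
  next
    case False
    have "Factorial_Ring.irreducible (map_poly of_int (- q) :: rat poly)"
      using irr irreducible_mult_unit_left[of "-1" "map_poly of_int q :: rat poly"] unfolding neg by simp
    then show ?thesis using that[of "- q"] lq False q(2) by auto
  qed
qed

lemma ev_of_int_poly: "ev (map_poly of_int q) z = evi q z"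
  by (induction q) (auto simp: map_poly_pCons)

subsection \<open>Kronecker's theorem on the interval from -2 to 2\<close>

text \<open>Multiplying by a linear factor X - r forms differences
  \<open>coeff q j - r * coeff q i\<close>, which costs at most a factor 1 + R.\<close>

lemma norm_coeff_le_of_roots:
  fixes p :: "complex poly"
  assumes "lead_coeff p = 1" "\<And>z. poly p z = 0 \<Longrightarrow> norm z \<le> R" "R \<ge> 0"
  shows "norm (coeff p i) \<le> (1 + R) ^ degree p"
  using assms(1,2)
proof (induction "degree p" arbitrary: p i)
  case 0
  then obtain c where "p = [:c:]" by (metis degree_eq_zeroE)
  then show ?case using 0 by (cases i) auto
next
  case (Suc n)
  then have "\<not> constant (poly p)" by (metis constant_degree nat.distinct(1))
  then obtain r where r: "poly p r = 0" using fundamental_theorem_of_algebra by blast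
  then obtain q where q: "p = [:- r, 1:] * q" by (metis dvdE poly_eq_0_iff_dvd)
  have q0: "q \<noteq> 0" using Suc.hyps(2) q by auto
  have dq: "n = degree q" using Suc.hyps(2) q q0 by (simp add: degree_mult_eq del: mult_pCons_left)
  have lq: "lead_coeff q = 1" using Suc.prems(1) unfolding q lead_coeff_mult by simp
  have IH: "norm (coeff q j) \<le> (1 + R) ^ n" for j
    using Suc.hyps(1)[OF dq lq, of j] Suc.prems(2) unfolding dq q by (auto simp: poly_mult)
  have rR: "norm r \<le> R" using Suc.prems(2) r by blast
  have "norm (coeff p i) \<le> norm r * norm (coeff q i) + (1 + R) ^ n"
  proof (cases i)
    case 0
    then show ?thesis using assms(3) unfolding q by (simp add: norm_mult)
  next
    case (Suc j)
    have "norm (coeff p i) = norm (coeff q j - r * coeff q i)" unfolding q Suc by simp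
    also have "\<dots> \<le> norm (coeff q j) + norm r * norm (coeff q i)"
      using norm_triangle_ineq4 by (metis norm_mult)
    finally show ?thesis using IH[of j] by simp
  qed
  also have "\<dots> \<le> R * (1 + R) ^ n + (1 + R) ^ n"
    using mult_mono[OF rR IH[of i]] assms(3) by simp
  also have "\<dots> = (1 + R) ^ degree p" using Suc.hyps(2) by (simp flip: Suc.hyps(2) add: algebra_simps)
  finally show ?case .
qed

text \<open>Bounded integer coefficients leave finitely many coefficient lists. This serves
  Kronecker's theorem and, later, the integers in a fixed field of the tower.\<close>

lemma finite_monic_int_polys:
  assumes "R \<ge> 0"
  shows "finite {q :: int poly. lead_coeff q = 1 \<and> degree q \<le> d \<and> (\<forall>z. evi q z = 0 \<longrightarrow> norm z \<le> R)}"
    (is "finite ?S")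
proof -
  define M where "M = \<lfloor>(1 + R) ^ d\<rfloor>"
  have "?S \<subseteq> Poly ` {xs. set xs \<subseteq> {-M..M} \<and> length xs \<le> Suc d}"
  proof
    fix q assume q: "q \<in> ?S"
    have "\<bar>coeff q i\<bar> \<le> M" for i
    proof -
      have "norm (coeff (map_poly of_int q :: complex poly) i) \<le> (1 + R) ^ degree (map_poly of_int q :: complex poly)"
        using q assms by (intro norm_coeff_le_of_roots) (auto simp: coeff_map_poly degree_map_poly)
      also have "\<dots> \<le> (1 + R) ^ d" using q assms by (intro power_increasing) (auto simp: degree_map_poly)
      finally show ?thesis unfolding M_def by (simp add: coeff_map_poly le_floor_iff)
    qed
    then have "set (coeffs q) \<subseteq> {-M..M}" unfolding coeffs_def by (auto simp: abs_le_iff minus_le_iff)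
    moreover have "length (coeffs q) \<le> Suc d" using q by (auto simp: coeffs_def)
    moreover have "q = Poly (coeffs q)" by simp
    ultimately show "q \<in> Poly ` {xs. set xs \<subseteq> {-M..M} \<and> length xs \<le> Suc d}" by blast
  qed
  then show ?thesis by (rule finite_subset) (simp add: finite_lists_length_le)
qed

lemma finite_roots_monic_int_polys:
  assumes "R \<ge> 0"
  shows "finite {a. \<exists>q :: int poly. lead_coeff q = 1 \<and> degree q \<le> d \<and> evi q a = 0 \<and>
    (\<forall>z. evi q z = 0 \<longrightarrow> norm z \<le> R)}" (is "finite ?A")
proof -
  have "?A = (\<Union>q \<in> {q. lead_coeff q = 1 \<and> degree q \<le> d \<and> (\<forall>z. evi q z = 0 \<longrightarrow> norm z \<le> R)}. {a. evi q a = 0})"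
    by blast
  also have "finite \<dots>"
    using finite_monic_int_polys[OF assms, of d]
    by (intro finite_UN_I) (auto intro!: poly_roots_finite simp: poly_eq_iff coeff_map_poly)
  finally show ?thesis .
qed

text \<open>Graeffe's method: \<open>q(X) q(-X)\<close> is a polynomial in \<open>X\<^sup>2 - 2\<close>.\<close>

lemma graeffe:
  fixes q :: "int poly"
  assumes "lead_coeff q = 1"
  obtains Q :: "int poly" where "lead_coeff Q = 1" "degree Q = degree q"
    "\<And>y. evi Q y = 0 \<longleftrightarrow> (\<exists>w. w\<^sup>2 - 2 = y \<and> evi q w = 0)"
proof -
  obtain A B where AB: "q = A \<circ>\<^sub>p [:- 2, 0, 1:] + [:0, 1:] * (B \<circ>\<^sub>p [:- 2, 0, 1:])"
    by (rule even_odd_decomposition)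
  \<comment> \<open>With t = X^2 - 2 one has q(X) q(-X) = A(t)^2 - X^2 B(t)^2, and X^2 = t +
    2.\<close>
  define Q0 where "Q0 = A\<^sup>2 - [:2, 1:] * B\<^sup>2"
  define s where "s = [:0, -1 :: int:]"
  have q0: "q \<noteq> 0" using assms by auto
  have t: "[:- 2, 0, 1:] \<circ>\<^sub>p s = [:- 2, 0, 1:]" unfolding s_def by (simp add: pcompose_pCons)
  have qs: "q \<circ>\<^sub>p s = A \<circ>\<^sub>p [:- 2, 0, 1:] - [:0, 1:] * (B \<circ>\<^sub>p [:- 2, 0, 1:])"
    by (subst AB, unfold pcompose_add pcompose_mult, unfold pcompose_assoc [symmetric] t)
      (simp add: pcompose_pCons s_def)
  have xx: "[:2, 1:] \<circ>\<^sub>p [:- 2, 0, 1:] = ([:0, 1:] * [:0, 1:] :: int poly)"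
    by (simp add: pcompose_pCons)
  have e: "q * (q \<circ>\<^sub>p s) = Q0 \<circ>\<^sub>p [:- 2, 0, 1:]"
    unfolding qs Q0_def pcompose_diff pcompose_mult power2_eq_square xx by (subst AB) (simp only: algebra_simps)
  have ds: "degree s = 1" "lead_coeff s = -1" unfolding s_def by auto
  have lqs: "lead_coeff (q \<circ>\<^sub>p s) = (-1) ^ degree q" using ds assms lead_coeff_comp[of s q] by simp
  then have qs0: "q \<circ>\<^sub>p s \<noteq> 0" by auto
  have "degree (q * (q \<circ>\<^sub>p s)) = 2 * degree q"
    using q0 qs0 ds by (simp add: degree_mult_eq degree_pcompose)
  then have dQ: "degree Q0 = degree q" using e by (simp add: degree_pcompose)
  have lQ: "lead_coeff Q0 = (-1) ^ degree q"
    using arg_cong[OF e, of lead_coeff] lqs assms lead_coeff_comp[of "[:- 2, 0, 1:]" Q0]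
    by (simp add: lead_coeff_mult)
  \<comment> \<open>The leading coefficient of q(-X) is this same sign, so \<open>Q\<close> is
    monic.\<close>
  define Q where "Q = smult ((-1) ^ degree q) Q0"
  have ev: "evi Q0 (w\<^sup>2 - 2) = evi q w * evi q (- w)" for w
    using arg_cong[OF e, of "\<lambda>p. evi p w"] unfolding s_def by (simp add: power2_eq_square)
  have Q: "evi Q y = 0 \<longleftrightarrow> evi Q0 y = 0" for y unfolding Q_def by simp
  show ?thesis
  proof (rule that[of Q])
    show "lead_coeff Q = 1" unfolding Q_def using lQ dQ by (simp flip: power_mult_distrib)
    show "degree Q = degree q" unfolding Q_def using dQ by simp
    fix y
    \<comment> \<open>Either this square root or its negative is the required root of
      \<open>q\<close>.\<close>
    have "(csqrt (y + 2))\<^sup>2 - 2 = y" by simp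
    then show "evi Q y = 0 \<longleftrightarrow> (\<exists>w. w\<^sup>2 - 2 = y \<and> evi q w = 0)"
      unfolding Q using ev by (metis mult_eq_0_iff power2_minus)
  qed
qed

text \<open>The map z^2 - 2 sends [-2, 2] into itself, and Graeffe's method keeps the polynomials
  monic, integral and of the same degree. So all iterates lie in one finite set.\<close>

lemma orbit_not_injective:
  fixes q :: "int poly"
  assumes "lead_coeff q = 1" "evi q \<gamma> = 0"
    and roots: "\<And>z. evi q z = 0 \<Longrightarrow> z \<in> \<real> \<and> \<bar>Re z\<bar> \<le> 2"
  obtains i j where "i < j" "((\<lambda>z. z\<^sup>2 - 2) ^^ i) \<gamma> = ((\<lambda>z. z\<^sup>2 - 2) ^^ j) (\<gamma> :: complex)"
proof -
  let ?T = "\<lambda>z :: complex. z\<^sup>2 - 2"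
  have step: "\<exists>Q :: int poly. lead_coeff Q = 1 \<and> degree Q = degree q \<and> evi Q ((?T ^^ k) \<gamma>) = 0 \<and>
    (\<forall>z. evi Q z = 0 \<longrightarrow> z \<in> \<real> \<and> \<bar>Re z\<bar> \<le> 2)" for k
  proof (induction k)
    case 0
    show ?case using assms by auto
  next
    case (Suc k)
    then obtain Q :: "int poly" where Q: "lead_coeff Q = 1" "degree Q = degree q" "evi Q ((?T ^^ k) \<gamma>) = 0"
      "\<And>z. evi Q z = 0 \<Longrightarrow> z \<in> \<real> \<and> \<bar>Re z\<bar> \<le> 2" by blast
    obtain Q' where Q': "lead_coeff Q' = 1" "degree Q' = degree Q"
      "\<And>y. evi Q' y = 0 \<longleftrightarrow> (\<exists>w. w\<^sup>2 - 2 = y \<and> evi Q w = 0)"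
      using graeffe[OF Q(1)] by metis
    have "z \<in> \<real> \<and> \<bar>Re z\<bar> \<le> 2" if "evi Q' z = 0" for z
    proof -
      obtain w where w: "w\<^sup>2 - 2 = z" "evi Q w = 0" using Q'(3) \<open>evi Q' z = 0\<close> by blast
      then obtain t where t: "w = of_real t" "\<bar>t\<bar> \<le> 2" using Q(4)[OF w(2)] by (auto elim!: Reals_cases)
      have "t\<^sup>2 \<le> 2\<^sup>2" using t(2) by (metis abs_le_square_iff abs_numeral)
      then have "\<bar>t\<^sup>2 - 2\<bar> \<le> 2" by (simp add: abs_le_iff)
      moreover have "z = of_real (t\<^sup>2 - 2)" using w(1) t(1) by simp
      ultimately show ?thesis by (metis Re_complex_of_real Reals_of_real)
    qed
    moreover have "evi Q' ((?T ^^ Suc k) \<gamma>) = 0" using Q'(3) Q(3) by auto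
    ultimately show ?case using Q'(1,2) Q(2) by (auto intro!: exI[of _ Q'] simp del: funpow.simps)
  qed
  let ?B = "{a. \<exists>Q :: int poly. lead_coeff Q = 1 \<and> degree Q \<le> degree q \<and> evi Q a = 0 \<and>
    (\<forall>z. evi Q z = 0 \<longrightarrow> norm z \<le> 2)}"
  have nr: "norm z = \<bar>Re z\<bar>" if "z \<in> \<real>" for z :: complex
    using that by (auto elim!: Reals_cases)
  have "(?T ^^ k) \<gamma> \<in> ?B" for k
  proof -
    obtain Q :: "int poly" where "lead_coeff Q = 1" "degree Q = degree q" "evi Q ((?T ^^ k) \<gamma>) = 0"
      "\<forall>z. evi Q z = 0 \<longrightarrow> z \<in> \<real> \<and> \<bar>Re z\<bar> \<le> 2" using step[of k] by blast
    then show ?thesis by (intro CollectI exI[of _ Q]) (simp add: nr)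
  qed
  then have "range (\<lambda>k. (?T ^^ k) \<gamma>) \<subseteq> ?B" by blast
  then have "finite (range (\<lambda>k. (?T ^^ k) \<gamma>))"
    by (rule finite_subset) (rule finite_roots_monic_int_polys, simp)
  then have "\<not> inj (\<lambda>k. (?T ^^ k) \<gamma>)" using finite_imageD by (metis infinite_UNIV_nat)
  then obtain i j where "i \<noteq> j" "(?T ^^ i) \<gamma> = (?T ^^ j) \<gamma>" by (auto simp: inj_def)
  then show ?thesis using that[of i j] that[of j i] by (cases i j rule: linorder_cases) auto
qed

text \<open>The Chebyshev recursion T(n+2) = X T(n+1) - T(n) involves two earlier indices, so the
  induction carries a pair.\<close>

lemma chebyshev_poly:
  obtains P :: "rat poly" where "\<And>v. v \<noteq> 0 \<Longrightarrow> ev P (v + inverse v) = v ^ n + inverse v ^ n"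
proof -
  have "\<exists>P Q :: rat poly. \<forall>v. v \<noteq> 0 \<longrightarrow> ev P (v + inverse v) = v ^ n + inverse v ^ n \<and>
    ev Q (v + inverse v) = v ^ Suc n + inverse v ^ Suc n"
  proof (induction n)
    case 0
    show ?case by (rule exI[of _ "[:2:]"], rule exI[of _ "[:0, 1:]"]) auto
  next
    case (Suc n)
    then obtain P Q :: "rat poly" where PQ: "\<And>v. v \<noteq> 0 \<Longrightarrow> ev P (v + inverse v) = v ^ n + inverse v ^ n"
      "\<And>v. v \<noteq> 0 \<Longrightarrow> ev Q (v + inverse v) = v ^ Suc n + inverse v ^ Suc n" by blast
    have "ev ([:0, 1:] * Q - P) (v + inverse v) = v ^ Suc (Suc n) + inverse v ^ Suc (Suc n)" if "v \<noteq> 0" for v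
      using that unfolding rat.ev_diff rat.ev_mult PQ[OF that]
      by (simp add: algebra_simps) (simp add: mult.assoc [symmetric])
    then show ?case using PQ(2) by blast
  qed
  then show ?thesis using that by blast
qed

text \<open>The difference of the two sums, times a b, is (a - b)(a b - 1).\<close>

lemma add_inverse_eq_iff:
  fixes a b :: complex
  assumes "a \<noteq> 0" "b \<noteq> 0"
  shows "a + inverse a = b + inverse b \<longleftrightarrow> a = b \<or> a * b = 1"
proof -
  have "(a + p - (b + q)) * (a * b) = (a - b) * (a * b - 1)" if "p * a = 1" "q * b = 1" for p q
  proof -
    have "(a + p - (b + q)) * (a * b) = a * a * b + (p * a) * b - b * a * b - (q * b) * a"
      by (simp add: algebra_simps)
    then show ?thesis unfolding that by (simp add: algebra_simps)
  qed
  from this[of "inverse a" "inverse b"]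
  have "(a + inverse a - (b + inverse b)) * (a * b) = (a - b) * (a * b - 1)"
    using assms by simp
  then show ?thesis using assms by (metis (no_types) eq_iff_diff_eq_0 mult_eq_0_iff)
qed

lemma obtain_add_inverse:
  obtains w :: complex where "w \<noteq> 0" "z = w + inverse w"
proof -
  \<comment> \<open>A root of w^2 - z w + 1; the other root is its inverse.\<close>
  define w where "w = (z + csqrt (z\<^sup>2 - 4)) / 2"
  have "(2 * w - z)\<^sup>2 = z\<^sup>2 - 4" unfolding w_def by simp
  then have "4 * (w * (z - w)) = 4 * 1" by (simp add: power2_eq_square algebra_simps)
  then have *: "w * (z - w) = 1" by simp
  then have "w \<noteq> 0" by auto
  then show ?thesis using inverse_unique[OF *] that[of w] by simp
qed

text \<open>Write \<open>\<gamma> = w + w\<^sup>-\<^sup>1\<close>: the coincidence makes \<open>w\<close> a root of unity, say of order \<open>N\<close>; then \<open>\<gamma>\<close> is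
  a root of the polynomial whose roots are the \<open>v + v\<^sup>-\<^sup>1\<close> with \<open>v ^ N = 1\<close>, and each such \<open>v\<close> is a
  power of \<open>w\<close>.\<close>

lemma preperiodic_imp_normal:
  assumes "i < j" "((\<lambda>z. z\<^sup>2 - 2) ^^ i) \<gamma> = ((\<lambda>z. z\<^sup>2 - 2) ^^ j) (\<gamma> :: complex)"
  obtains C :: "rat poly" where "ev C \<gamma> = 0" "\<And>\<beta>. ev C \<beta> = 0 \<Longrightarrow> \<exists>P. \<beta> = ev P \<gamma>"
proof -
  obtain w where w: "w \<noteq> 0" "\<gamma> = w + inverse w" by (rule obtain_add_inverse)
  \<comment> \<open>On w + 1/w the map z^2 - 2 acts by squaring \<open>w\<close>.\<close>
  have it: "((\<lambda>z. z\<^sup>2 - 2) ^^ k) \<gamma> = w ^ 2 ^ k + inverse (w ^ 2 ^ k)" for k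
  proof (induction k)
    case (Suc k)
    have "(a + inverse a)\<^sup>2 - 2 = a\<^sup>2 + inverse (a\<^sup>2)" if "a \<noteq> 0" for a :: complex
      using that by (simp add: power2_sum power_inverse)
    from this[of "w ^ 2 ^ k"]
    have "((\<lambda>z. z\<^sup>2 - 2) ^^ Suc k) \<gamma> = (w ^ 2 ^ k)\<^sup>2 + inverse ((w ^ 2 ^ k)\<^sup>2)"
      using Suc w(1) by simp
    also have "(w ^ 2 ^ k)\<^sup>2 = w ^ 2 ^ Suc k" by (simp flip: power_mult add: mult.commute)
    finally show ?case .
  qed (simp add: w)
  have "w ^ 2 ^ i = w ^ 2 ^ j \<or> w ^ 2 ^ i * w ^ 2 ^ j = 1"
    using assms(2) w(1) unfolding it by (subst (asm) add_inverse_eq_iff) auto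
  then have "\<exists>N. 0 < N \<and> w ^ N = 1"
  proof
    assume a: "w ^ 2 ^ i = w ^ 2 ^ j"
    have lt: "(2::nat) ^ i < 2 ^ j" using assms(1) by simp
    have "w ^ 2 ^ j = w ^ 2 ^ i * w ^ (2 ^ j - 2 ^ i)" using lt by (simp flip: power_add)
    then have "w ^ (2 ^ j - 2 ^ i) = 1" using a w(1) by simp
    then show ?thesis using lt zero_less_diff by blast
  next
    assume "w ^ 2 ^ i * w ^ 2 ^ j = 1"
    then show ?thesis by (intro exI[of _ "2 ^ i + 2 ^ j"]) (simp add: power_add)
  qed
  then obtain N where N: "0 < N" "w ^ N = 1" and least: "\<And>M. 0 < M \<Longrightarrow> w ^ M = 1 \<Longrightarrow> N \<le> M"
    using LeastI_ex[of "\<lambda>N. 0 < N \<and> w ^ N = 1"] Least_le[of "\<lambda>N. 0 < N \<and> w ^ N = 1"] by blast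
  have "inj_on (\<lambda>k. w ^ k) {..<N}"
  proof (rule linorder_inj_onI')
    fix k l assume kl: "k \<in> {..<N}" "l \<in> {..<N}" "k < l"
    show "w ^ k \<noteq> w ^ l"
    proof
      assume "w ^ k = w ^ l"
      moreover have "w ^ l = w ^ k * w ^ (l - k)" using kl by (simp flip: power_add)
      ultimately have "w ^ (l - k) = 1" using w(1) by simp
      then show False using least[of "l - k"] kl by simp
    qed
  qed
  then have "card ((\<lambda>k. w ^ k) ` {..<N}) = N" by (simp add: card_image)
  moreover have "(\<lambda>k. w ^ k) ` {..<N} \<subseteq> {z. z ^ N = 1}"
    using N(2) by (auto simp flip: power_mult) (metis mult.commute power_mult power_one)
  \<comment> \<open>The \<open>N\<close> distinct powers of \<open>w\<close> exhaust the
    \<open>N\<close>-th roots of unity.\<close>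
  ultimately have roots: "(\<lambda>k. w ^ k) ` {..<N} = {z. z ^ N = 1}"
    using N(1) by (intro card_subset_eq) (auto simp: card_roots_unity_eq finite_roots_unity)
  obtain C :: "rat poly" where C: "\<And>v. v \<noteq> 0 \<Longrightarrow> ev C (v + inverse v) = v ^ N + inverse v ^ N"
    using chebyshev_poly[of N] by blast
  \<comment> \<open>At v + 1/v the polynomial \<open>C - [:2:]\<close> is v^N + v^(-N) - 2, which
    vanishes exactly when v^N = 1.\<close>
  show ?thesis
  proof (rule that[of "C - [:2:]"])
    show "ev (C - [:2:]) \<gamma> = 0" using C[OF w(1)] N(2) w(2) by (simp add: power_inverse)
    fix \<beta> assume b: "ev (C - [:2:]) \<beta> = 0"
    obtain v where v: "v \<noteq> 0" "\<beta> = v + inverse v" by (rule obtain_add_inverse)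
    have "v ^ N + inverse (v ^ N) = 1 + inverse 1" using b C[OF v(1)] v(2) by (simp add: power_inverse)
    then have "v ^ N = 1" using v(1) by (subst (asm) add_inverse_eq_iff) auto
    then obtain k where k: "v = w ^ k" using roots by auto
    obtain P :: "rat poly" where "\<And>v. v \<noteq> 0 \<Longrightarrow> ev P (v + inverse v) = v ^ k + inverse v ^ k"
      using chebyshev_poly[of k] by blast
    then show "\<exists>P. \<beta> = ev P \<gamma>" using w k v by (metis power_inverse)
  qed
qed

subsection \<open>Squares in the critical orbit\<close>

text \<open>Every square other than R^2 has distance at least 2 R - 1 from it.\<close>

lemma square_near_square:
  fixes k R D :: int
  assumes "k\<^sup>2 = R\<^sup>2 + D" "\<bar>D\<bar> < 2 * R - 1"
  shows "D = 0"
proof (rule ccontr)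
  assume "D \<noteq> 0"
  have R: "R > 0" using assms(2) by linarith
  consider "\<bar>k\<bar> \<ge> R + 1" | "\<bar>k\<bar> \<le> R - 1" | "\<bar>k\<bar> = R" by linarith
  then show False
  proof cases
    case 1
    then have "\<bar>R + 1\<bar> \<le> \<bar>k\<bar>" using R by simp
    then have "(R + 1)\<^sup>2 \<le> k\<^sup>2" by (simp only: abs_le_square_iff)
    then show ?thesis using assms by (simp add: power2_eq_square algebra_simps)
  next
    case 2
    then have "\<bar>k\<bar> \<le> \<bar>R - 1\<bar>" using R by simp
    then have "k\<^sup>2 \<le> (R - 1)\<^sup>2" by (simp only: abs_le_square_iff)
    then show ?thesis using assms by (simp add: power2_eq_square algebra_simps)
  next
    case 3
    then have "k\<^sup>2 = R\<^sup>2" by (metis power2_abs)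
    then show ?thesis using assms(1) \<open>D \<noteq> 0\<close> by simp
  qed
qed

text \<open>Runge's method: four times the product is the square of \<open>2 b\<^sup>3 - (2 \<nu> + c) b\<close> plus a
  remainder that is quadratic in \<open>b\<close> and vanishes identically only for \<open>\<nu> = 2\<close>.\<close>

lemma product_eventually_not_square:
  fixes \<nu> c :: int
  assumes "\<nu> \<ge> 3" "c > 0"
  obtains B where "\<And>b k. b \<ge> B \<Longrightarrow> ((b\<^sup>2 - \<nu>)\<^sup>2 - c) * (b\<^sup>2 - c) \<noteq> k\<^sup>2"
proof -
  define e1 where "e1 = c * (4 * \<nu> - 4 - c)"
  define e2 where "e2 = 4 * c * (\<nu>\<^sup>2 - c)"
  \<comment> \<open>The threshold lets the cubic term of \<open>R\<close> dominate both its linear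
    term and the bound (|e1| + |e2|) b^2 for \<open>D\<close>.\<close>
  have "((b\<^sup>2 - \<nu>)\<^sup>2 - c) * (b\<^sup>2 - c) \<noteq> k\<^sup>2" if b: "b \<ge> \<bar>e1\<bar> + \<bar>e2\<bar> + 2 * \<nu> + c + 2" for b k
  proof
    assume k: "((b\<^sup>2 - \<nu>)\<^sup>2 - c) * (b\<^sup>2 - c) = k\<^sup>2"
    define R where "R = 2 * b^3 - (2 * \<nu> + c) * b"
    define D where "D = e1 * b\<^sup>2 - e2"
    have "(2 * k)\<^sup>2 = 4 * (((b\<^sup>2 - \<nu>)\<^sup>2 - c) * (b\<^sup>2 - c))" using k by (simp add: power2_eq_square)
    also have "\<dots> = R\<^sup>2 + D" unfolding R_def D_def e1_def e2_def
      by (simp add: power2_eq_square power3_eq_cube algebra_simps)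
    finally have sq: "(2 * k)\<^sup>2 = R\<^sup>2 + D" .
    have b1: "b \<ge> 1" using b assms by linarith
    have bb: "b \<le> b * b" using b1 by (simp add: mult_le_cancel_left1)
    have bb1: "1 \<le> b * b" using bb b1 by linarith
    have "\<bar>D\<bar> \<le> \<bar>e1\<bar> * (b * b) + \<bar>e2\<bar> * 1"
      unfolding D_def using abs_triangle_ineq4[of "e1 * b\<^sup>2" e2] by (simp add: abs_mult power2_eq_square)
    also have "\<dots> \<le> \<bar>e1\<bar> * (b * b) + \<bar>e2\<bar> * (b * b)" using bb1 by (simp add: mult_left_mono del: mult_1_right)
    finally have D: "\<bar>D\<bar> \<le> (\<bar>e1\<bar> + \<bar>e2\<bar>) * (b * b)" by (simp add: algebra_simps)
    have "(\<bar>e1\<bar> + \<bar>e2\<bar> + 2 * \<nu> + c + 2) * (b * b) \<le> b * (b * b)" using b bb1 by (intro mult_right_mono) auto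
    moreover have "(2 * \<nu> + c) * b \<le> (2 * \<nu> + c) * (b * b)" using bb assms by (intro mult_left_mono) auto
    moreover have "(\<bar>e1\<bar> + \<bar>e2\<bar> + 2 * \<nu> + c) * (b * b) \<ge> 0" using assms by simp
    moreover have "(2 * \<nu> + c) * (b * b) \<ge> 0" using assms by simp
    ultimately have "\<bar>D\<bar> < 2 * R - 1" using D bb1 unfolding R_def power3_eq_cube
      by (simp add: algebra_simps)
    with sq have D0: "D = 0" by (rule square_near_square)
    show False
    proof (cases "4 * \<nu> - 4 - c = 0")
      case True
      \<comment> \<open>Here c = 4 \<nu> - 4, and the remainder is the constant -e2, nonzero because
        \<nu> is not 2.\<close>
      then have "\<nu>\<^sup>2 - c = (\<nu> - 2)\<^sup>2" by (simp add: power2_eq_square algebra_simps)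
      then have "e2 \<noteq> 0" unfolding e2_def using assms by auto
      then show ?thesis using D0 True unfolding D_def e1_def by simp
    next
      case False
      then have "\<bar>e1\<bar> \<ge> 1" unfolding e1_def using assms by (simp add: int_one_le_iff_zero_less)
      then have "1 * (b * b) \<le> \<bar>e1\<bar> * (b * b)" using bb1 by (intro mult_right_mono) auto
      moreover have "\<bar>e1\<bar> * (b * b) = \<bar>e2\<bar>" using D0 bb1 unfolding D_def by (auto simp: power2_eq_square abs_mult)
      ultimately show ?thesis using bb b assms by linarith
    qed
  qed
  then show ?thesis using that by blast
qed

text \<open>The orbit starts 0, -\<nu>, \<nu>^2 - \<nu>. From index 2 on it increases, so it passes
  every threshold from Runge's method.\<close>

lemma critical_orbit_ge:
  fixes \<nu> :: int
  assumes "\<nu> \<ge> 3"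
  shows "((\<lambda>z. z\<^sup>2 - \<nu>) ^^ (m + 2)) 0 \<ge> 2 * \<nu> + int m"
proof (induction m)
  case 0
  have "3 * \<nu> \<le> \<nu> * \<nu>" using assms by simp
  then show ?case by (simp add: numeral_2_eq_2 power2_eq_square)
next
  case (Suc m)
  define a where "a = ((\<lambda>z. z\<^sup>2 - \<nu>) ^^ (m + 2)) 0"
  have a: "a \<ge> 2 * \<nu> + int m" using Suc a_def by simp
  have "3 * a \<le> a * a" using a assms by (intro mult_right_mono) auto
  then have "a\<^sup>2 - \<nu> \<ge> 2 * \<nu> + int (Suc m)" unfolding power2_eq_square using a assms by linarith
  then show ?case by (simp add: a_def)
qed

lemma critical_orbit_eventually_not_square:
  fixes \<nu> x0 :: nat
  assumes "\<nu> \<ge> 3"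
  defines "a \<equiv> \<lambda>m. ((\<lambda>z. z\<^sup>2 - int \<nu>) ^^ m) 0"
  obtains N where "\<And>m k. m \<ge> N \<Longrightarrow> a (m + 2) - int x0 \<noteq> k\<^sup>2"
    "\<And>m k. m \<ge> N \<Longrightarrow> (a (m + 2) - int x0) * (a (m + 1) - int x0) \<noteq> k\<^sup>2"
proof -
  \<comment> \<open>With this \<open>c\<close> and b = \<open>a m\<close>, the two differences in
    the product are b^2 - c and (b^2 - \<nu>)^2 - c, as in
    \<open>product_eventually_not_square\<close>.\<close>
  define c where "c = int \<nu> + int x0"
  have c: "c > 0" "int \<nu> \<ge> 3" using assms(1) c_def by auto
  obtain B where B: "\<And>b k. b \<ge> B \<Longrightarrow> ((b\<^sup>2 - int \<nu>)\<^sup>2 - c) * (b\<^sup>2 - c) \<noteq> k\<^sup>2"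
    using product_eventually_not_square[OF c(2,1)] by blast
  have ge: "a m \<ge> max B c" if "m \<ge> nat (max B c) + 2" for m
  proof -
    have "m - 2 + 2 = m" using that by simp
    then have "a m \<ge> 2 * int \<nu> + int (m - 2)"
      using critical_orbit_ge[OF c(2), of "m - 2"] unfolding a_def by metis
    then show ?thesis using that by linarith
  qed
  have a1: "a (m + 1) = (a m)\<^sup>2 - int \<nu>" for m unfolding a_def by simp
  have a2: "a (m + 2) = (a (m + 1))\<^sup>2 - int \<nu>" for m using a1[of "m + 1"] by simp
  show ?thesis
  proof (rule that[of "nat (max B c) + 2"])
    fix m k assume m: "m \<ge> nat (max B c) + 2"
    have "a (m + 1) \<ge> c" using ge[of "m + 1"] m by simp
    then have "\<bar>- c\<bar> < 2 * a (m + 1) - 1 \<or> c = 1" using c by auto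
    moreover have "c \<ge> 3" using c_def assms(1) by simp
    ultimately have "k\<^sup>2 \<noteq> (a (m + 1))\<^sup>2 + (- c)" using square_near_square[of k "a (m + 1)" "- c"] c by auto
    then show "a (m + 2) - int x0 \<noteq> k\<^sup>2" unfolding a2 c_def by auto
    show "(a (m + 2) - int x0) * (a (m + 1) - int x0) \<noteq> k\<^sup>2"
      using B[of "a m" k] ge[OF m] unfolding a2 a1 c_def by (simp add: algebra_simps)
  qed
qed

subsection \<open>The tower of square roots\<close>

text \<open>The values of the \<open>n\<close>-th term over all choices of signs; in the locale
  below, the conjugates of \<open>x n\<close>.\<close>

primrec tower_values :: "nat \<Rightarrow> nat \<Rightarrow> nat \<Rightarrow> complex set" where
  "tower_values \<nu> x0 0 = {of_nat x0}"
| "tower_values \<nu> x0 (Suc n) = {z. z\<^sup>2 - of_nat \<nu> \<in> tower_values \<nu> x0 n}"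

text \<open>The degree 2 condition is encoded by \<open>irr\<close>: a root of a quadratic over the
  field of \<open>x n\<close> is not a polynomial in \<open>x n\<close>. Signs stay free.\<close>

locale sqrt_tower =
  fixes \<nu> x0 :: nat and x :: "nat \<Rightarrow> complex"
  assumes x_0: "x 0 = of_nat x0"
    and x_Suc: "(x (Suc n))\<^sup>2 = of_nat \<nu> + x n"
    and irr: "x (Suc n) \<notin> range (\<lambda>p. ev p (x n))"
begin

abbreviation Y :: "nat \<Rightarrow> complex set" where "Y \<equiv> tower_values \<nu> x0"

text \<open>Polynomial expressions already form a field, by \<open>K_inverse\<close>;
  \<open>tower_field_eq\<close> identifies it with the generated field.\<close>

definition K :: "nat \<Rightarrow> complex set" where "K n = range (\<lambda>p. ev p (x n))"

lemma K_I: "ev p (x n) \<in> K n"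
  by (auto simp: K_def)

lemma K_E: assumes "a \<in> K n" obtains p where "a = ev p (x n)"
  using assms by (auto simp: K_def)

lemma x_Suc_notin: "x (Suc n) \<notin> K n"
  using irr by (simp add: K_def)

lemma K_add: "a \<in> K n \<Longrightarrow> b \<in> K n \<Longrightarrow> a + b \<in> K n"
  by (metis K_I K_E rat.ev_add)

lemma K_mult: "a \<in> K n \<Longrightarrow> b \<in> K n \<Longrightarrow> a * b \<in> K n"
  by (metis K_I K_E rat.ev_mult)

lemma K_diff: "a \<in> K n \<Longrightarrow> b \<in> K n \<Longrightarrow> a - b \<in> K n"
  by (metis K_I K_E rat.ev_diff)

lemma K_uminus: "a \<in> K n \<Longrightarrow> - a \<in> K n"
  by (metis K_I K_E rat.ev_uminus)

lemma K_power: "a \<in> K n \<Longrightarrow> a ^ k \<in> K n"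
  by (metis K_I K_E rat.ev_power)

lemma K_of_rat: "of_rat r \<in> K n"
  using K_I[of "[:r:]" n] by simp

lemma K_numerals: "0 \<in> K n" "1 \<in> K n" "of_nat k \<in> K n" "numeral w \<in> K n"
  using K_of_rat[of 0] K_of_rat[of 1] K_of_rat[of "of_nat k"] K_of_rat[of "numeral w"] by simp_all

lemma K_x: "x n \<in> K n"
  using K_I[of "[:0, 1:]" n] by simp

lemmas K_closed = K_add K_mult K_diff K_uminus K_power K_numerals K_x

lemma K_ev: "a \<in> K n \<Longrightarrow> ev p a \<in> K n"
  by (metis K_I K_E rat.ev_pcompose)

lemma x_pred: "(x (Suc n))\<^sup>2 - of_nat \<nu> = x n"
  by (simp add: x_Suc)

lemma K_Suc_iff: "e \<in> K (Suc n) \<longleftrightarrow> (\<exists>a\<in>K n. \<exists>b\<in>K n. e = a + b * x (Suc n))"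
proof
  assume "e \<in> K (Suc n)"
  then obtain p where p: "e = ev p (x (Suc n))" by (rule K_E)
  obtain A B where "\<And>z. ev p z = ev A (z\<^sup>2 - of_nat \<nu>) + z * ev B (z\<^sup>2 - of_nat \<nu>)"
    using ev_even_odd_decomposition by blast
  then have "e = ev A (x n) + ev B (x n) * x (Suc n)" using p x_pred by simp
  then show "\<exists>a\<in>K n. \<exists>b\<in>K n. e = a + b * x (Suc n)" using K_I by blast
next
  assume "\<exists>a\<in>K n. \<exists>b\<in>K n. e = a + b * x (Suc n)"
  then obtain A B where "e = ev A (x n) + ev B (x n) * x (Suc n)" by (metis K_E)
  then have "e = ev (A \<circ>\<^sub>p [:- of_nat \<nu>, 0, 1:] + (B \<circ>\<^sub>p [:- of_nat \<nu>, 0, 1:]) * [:0, 1:]) (x (Suc n))"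
    using x_pred[of n] by (simp add: power2_eq_square)
  then show "e \<in> K (Suc n)" using K_I by blast
qed

lemma K_Suc: "K n \<subseteq> K (Suc n)"
proof
  fix a assume "a \<in> K n"
  moreover have "a = a + 0 * x (Suc n)" by simp
  ultimately show "a \<in> K (Suc n)" unfolding K_Suc_iff using K_numerals(1) by blast
qed

lemma K_mono: "m \<le> n \<Longrightarrow> K m \<subseteq> K n"
  using lift_Suc_mono_le[of K] K_Suc by blast

lemma K_0: "K 0 = range of_rat"
proof -
  have "ev p (x 0) \<in> range of_rat" for p
    by (simp add: x_0 ev_of_nat)
  then show ?thesis using K_of_rat by (auto simp: K_def)
qed

text \<open>The product of b + c x(n+1) and its conjugate b - c x(n+1) is an element
  \<open>d\<close> of \<open>K n\<close>, inverted by induction. If \<open>d\<close> is 0, so is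
  \<open>c\<close>, since otherwise x(n+1) would lie in \<open>K n\<close>.\<close>

lemma K_inverse: "a \<in> K n \<Longrightarrow> inverse a \<in> K n"
proof (induction n arbitrary: a)
  case 0
  then obtain r where "a = of_rat r" unfolding K_0 by blast
  then have "inverse a = of_rat (inverse r)" by (simp add: of_rat_inverse)
  then show ?case unfolding K_0 by blast
next
  case (Suc n)
  obtain b c where bc: "b \<in> K n" "c \<in> K n" "a = b + c * x (Suc n)" using Suc.prems K_Suc_iff by blast
  define d where "d = b\<^sup>2 - c\<^sup>2 * (of_nat \<nu> + x n)"
  have d: "d \<in> K n" unfolding d_def by (intro K_closed bc)
  have ad: "a * (b - c * x (Suc n)) = d"
    unfolding bc(3) d_def x_Suc[symmetric] by (simp add: power2_eq_square algebra_simps)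
  show ?case
  proof (cases "d = 0")
    case False
    then have "inverse a = (b - c * x (Suc n)) * inverse d"
      by (intro inverse_unique) (simp add: mult.assoc[symmetric] ad)
    moreover have "inverse d \<in> K (Suc n)" "b \<in> K (Suc n)" "c \<in> K (Suc n)" using Suc.IH[OF d] bc K_Suc by auto
    ultimately show ?thesis by (metis K_mult K_diff K_x)
  next
    case True
    have "c = 0"
    proof (rule ccontr)
      assume c: "c \<noteq> 0"
      have "(b + c * x (Suc n)) * (b - c * x (Suc n)) = 0" using ad True bc by simp
      then have "c * x (Suc n) = - b \<or> c * x (Suc n) = b"
        by (auto simp: add_eq_0_iff)
      then have "c * x (Suc n) \<in> K n" using bc K_uminus by auto
      then have "inverse c * (c * x (Suc n)) \<in> K n" using Suc.IH[OF bc(2)] by (rule K_mult[rotated])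
      then show False using x_Suc_notin c by (simp add: mult.assoc[symmetric])
    qed
    then have "a = 0" using True d_def bc by simp
    then show ?thesis using K_numerals by simp
  qed
qed

lemma K_divide: "a \<in> K n \<Longrightarrow> b \<in> K n \<Longrightarrow> a / b \<in> K n"
  unfolding divide_inverse by (intro K_mult K_inverse)

text \<open>In the square of a + b x(n+1) the coefficient 2 a b of x(n+1) has to vanish.\<close>

lemma K_square_mem:
  assumes "e \<in> K (Suc n)" "e\<^sup>2 \<in> K n"
  shows "e \<in> K n \<or> (\<exists>b\<in>K n. e = b * x (Suc n))"
proof -
  obtain a b where ab: "a \<in> K n" "b \<in> K n" "e = a + b * x (Suc n)" using assms K_Suc_iff by blast
  have "a = 0 \<or> b = 0"
  proof (rule ccontr)
    assume "\<not> ?thesis"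
    then have nz: "2 * a * b \<noteq> 0" by simp
    have "(2 * a * b) * x (Suc n) = e\<^sup>2 - a\<^sup>2 - b\<^sup>2 * (of_nat \<nu> + x n)"
      unfolding ab(3) x_Suc[symmetric] by (simp add: power2_eq_square algebra_simps)
    then have "x (Suc n) = (e\<^sup>2 - a\<^sup>2 - b\<^sup>2 * (of_nat \<nu> + x n)) / (2 * a * b)"
      using nz by (simp add: field_simps)
    moreover have "\<dots> \<in> K n" by (intro K_divide K_closed ab assms)
    ultimately show False using x_Suc_notin by metis
  qed
  then show ?thesis using ab by auto
qed

lemma x_in_Y: "x n \<in> Y n"
  by (induction n) (auto simp: x_0 x_Suc)

lemma Y_uminus: "z \<in> Y (Suc n) \<Longrightarrow> - z \<in> Y (Suc n)"
  by simp

text \<open>Write p = A + z B. If \<open>B\<close> did not vanish at the lower level, A^2 = (\<nu> +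
  x n) B^2 would put x(n+1) into \<open>K n\<close>. So both parts vanish there and, by induction,
  at every value of that level.\<close>

lemma transport:
  assumes "y \<in> Y n" "y' \<in> Y n" "ev p y = 0"
  shows "ev p y' = 0"
  using assms
proof (induction n arbitrary: y y' p)
  case (Suc n)
  obtain A B where AB: "\<And>z. ev p z = ev A (z\<^sup>2 - of_nat \<nu>) + z * ev B (z\<^sup>2 - of_nat \<nu>)"
    using ev_even_odd_decomposition by blast
  have y: "y\<^sup>2 - of_nat \<nu> \<in> Y n" "y'\<^sup>2 - of_nat \<nu> \<in> Y n" using Suc.prems by auto
  have "ev B (y\<^sup>2 - of_nat \<nu>) = 0"
  proof (rule ccontr)
    assume B: "ev B (y\<^sup>2 - of_nat \<nu>) \<noteq> 0"
    have "ev A (y\<^sup>2 - of_nat \<nu>) = - (y * ev B (y\<^sup>2 - of_nat \<nu>))"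
      using AB[of y] Suc.prems(3) by (simp add: eq_neg_iff_add_eq_0)
    then have "ev (A\<^sup>2 - [:of_nat \<nu>, 1:] * B\<^sup>2) (y\<^sup>2 - of_nat \<nu>) = 0"
      by (simp add: power2_eq_square algebra_simps)
    then have "ev (A\<^sup>2 - [:of_nat \<nu>, 1:] * B\<^sup>2) (x n) = 0" using Suc.IH y(1) x_in_Y by blast
    then have e: "(ev A (x n))\<^sup>2 = (x (Suc n) * ev B (x n))\<^sup>2"
      unfolding power_mult_distrib x_Suc by (simp add: algebra_simps)
    have "ev B (x n) \<noteq> 0" using B Suc.IH y(1) x_in_Y by blast
    then have "x (Suc n) = x (Suc n) * ev B (x n) / ev B (x n)" by simp
    moreover have "x (Suc n) * ev B (x n) \<in> K n"
      using e unfolding power2_eq_iff by (metis K_I K_uminus minus_minus)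
    ultimately show False using x_Suc_notin K_divide K_I by metis
  qed
  moreover from this have "ev A (y\<^sup>2 - of_nat \<nu>) = 0" using AB[of y] Suc.prems(3) by simp
  ultimately have "ev A (y'\<^sup>2 - of_nat \<nu>) = 0" "ev B (y'\<^sup>2 - of_nat \<nu>) = 0" using Suc.IH y by blast+
  then show ?case using AB[of y'] by simp
qed auto

lemma transport_eq:
  assumes "y \<in> Y n" "y' \<in> Y n" "ev p y = ev q y"
  shows "ev p y' = ev q y'"
  using transport[OF assms(1,2), of "p - q"] assms(3) by simp

end

subsection \<open>The norm of a function over the values of the tower\<close>

text \<open>For \<open>g = ev p\<close> in a \<open>sqrt_tower\<close> this is the norm of
  \<open>ev p (x n)\<close> from \<open>K n\<close> to the rationals, with the two square roots
  paired at each level.\<close>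

primrec tower_norm :: "nat \<Rightarrow> nat \<Rightarrow> nat \<Rightarrow> (complex \<Rightarrow> complex) \<Rightarrow> complex" where
  "tower_norm \<nu> x0 0 g = g (of_nat x0)"
| "tower_norm \<nu> x0 (Suc n) g =
     tower_norm \<nu> x0 n (\<lambda>y. g (csqrt (of_nat \<nu> + y)) * g (- csqrt (of_nat \<nu> + y)))"

lemma tower_norm_mult:
  "tower_norm \<nu> x0 n (\<lambda>y. g y * h y) = tower_norm \<nu> x0 n g * tower_norm \<nu> x0 n h"
proof (induction n arbitrary: g h)
  case (Suc n)
  show ?case by (simp add: Suc[symmetric] mult_ac)
qed auto

lemma tower_norm_cong:
  assumes "\<And>y. y \<in> tower_values \<nu> x0 n \<Longrightarrow> g y = h y"
  shows "tower_norm \<nu> x0 n g = tower_norm \<nu> x0 n h"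
  using assms
proof (induction n arbitrary: g h)
  case (Suc n)
  show ?case unfolding tower_norm.simps by (rule Suc.IH) (simp add: Suc.prems)
qed auto

text \<open>If s^2 = \<nu> + y, the factors at s and -s multiply to A(y)^2 - (\<nu> + y) B(y)^2,
  again a rational polynomial in y.\<close>

lemma tower_norm_rat: "\<exists>r. tower_norm \<nu> x0 n (ev p) = of_rat r"
proof (induction n arbitrary: p)
  case 0
  show ?case by (auto simp: ev_of_nat)
next
  case (Suc n)
  obtain A B where AB: "\<And>z. ev p z = ev A (z\<^sup>2 - of_nat \<nu>) + z * ev B (z\<^sup>2 - of_nat \<nu>)"
    using ev_even_odd_decomposition by blast
  have "ev p (csqrt (of_nat \<nu> + y)) * ev p (- csqrt (of_nat \<nu> + y)) = ev (A\<^sup>2 - [:of_nat \<nu>, 1:] * B\<^sup>2) y" for y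
  proof -
    have "(csqrt (of_nat \<nu> + y))\<^sup>2 = of_nat \<nu> + y" by simp
    moreover define s where "s = csqrt (of_nat \<nu> + y)"
    ultimately have s: "s\<^sup>2 = of_nat \<nu> + y" by simp
    then have "s\<^sup>2 - of_nat \<nu> = y" by simp
    then have p: "ev p s = ev A y + s * ev B y" "ev p (- s) = ev A y - s * ev B y"
      using AB[of s] AB[of "- s"] by simp_all
    have "ev p s * ev p (- s) = (ev A y)\<^sup>2 - s\<^sup>2 * (ev B y)\<^sup>2"
      unfolding p by (simp add: power2_eq_square algebra_simps)
    then show ?thesis unfolding s_def[symmetric] s by (simp add: algebra_simps)
  qed
  then show ?case using Suc[of "A\<^sup>2 - [:of_nat \<nu>, 1:] * B\<^sup>2"] by simp
qed

text \<open>Each level replaces w by w^2 - \<nu>, since (w - s)(w + s) = (w^2 - \<nu>) - y; norms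
  thus become terms of an orbit.\<close>

lemma tower_norm_linear:
  "tower_norm \<nu> x0 n (\<lambda>y. w - y) = ((\<lambda>z. z\<^sup>2 - of_nat \<nu>) ^^ n) w - of_nat x0"
proof (induction n arbitrary: w)
  case (Suc n)
  have "(w - csqrt (of_nat \<nu> + y)) * (w - - csqrt (of_nat \<nu> + y)) = (w\<^sup>2 - of_nat \<nu>) - y" for y
    using power2_csqrt[of "of_nat \<nu> + y"] by (simp add: power2_eq_square algebra_simps)
  then show ?case by (simp add: Suc funpow_swap1 del: funpow.simps(2) add: funpow_Suc_right)
qed auto

text \<open>From level 1 on the number of factors is even, so the change of sign cancels.\<close>

lemma tower_norm_linear':
  assumes "n \<ge> 1"
  shows "tower_norm \<nu> x0 n (\<lambda>y. y - w) = ((\<lambda>z. z\<^sup>2 - of_nat \<nu>) ^^ n) w - of_nat x0"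
proof -
  obtain m where n: "n = Suc m" using assms by (cases n) auto
  have "(csqrt (of_nat \<nu> + y) - w) * (- csqrt (of_nat \<nu> + y) - w) = (w\<^sup>2 - of_nat \<nu>) - y" for y
    using power2_csqrt[of "of_nat \<nu> + y"] by (simp add: power2_eq_square algebra_simps)
  then show ?thesis by (simp add: n tower_norm_linear funpow_Suc_right del: funpow.simps(2))
qed

lemma rat_square_int:
  assumes "of_rat r ^ 2 = (of_int i :: complex)"
  obtains k :: int where "i = k\<^sup>2"
proof -
  have r: "r\<^sup>2 = of_int i" using assms by (metis of_rat_eq_iff of_rat_of_int_eq of_rat_power)
  have "algebraic_int r"
    unfolding algebraic_int_altdef_ipoly
    by (rule exI[of _ "[:- i, 0, 1:]"]) (simp add: map_poly_pCons r[symmetric] power2_eq_square)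
  then have "r \<in> \<int>" by (rule rational_algebraic_int_is_int) (metis Rats_of_rat of_rat_eq_id id_apply)
  then obtain k where "r = of_int k" by (elim Ints_cases)
  then have "i = k\<^sup>2" using r by (metis of_int_eq_iff of_int_power)
  then show ?thesis by (rule that)
qed

lemma funpow_of_int:
  "((\<lambda>z. z\<^sup>2 - of_nat \<nu>) ^^ n) (of_int w) = (of_int (((\<lambda>z. z\<^sup>2 - int \<nu>) ^^ n) w) :: complex)"
  by (induction n) auto

section \<open>Square roots inside the tower and their norms\<close>

context sqrt_tower
begin

text \<open>The identity transports to all of \<open>Y m\<close>, so the norm of \<open>ev d\<close>
  is the square of the rational norm of \<open>ev c\<close>.\<close>

lemma norm_of_square:
  assumes "e \<in> K m" "e\<^sup>2 = ev d (x m)" "tower_norm \<nu> x0 m (ev d) = of_int i"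
  obtains k :: int where "i = k\<^sup>2"
proof -
  obtain c where c: "e = ev c (x m)" using assms(1) by (rule K_E)
  obtain r where r: "tower_norm \<nu> x0 m (ev c) = of_rat r" using tower_norm_rat by blast
  have "ev d y = ev c y * ev c y" if "y \<in> Y m" for y
    using transport_eq[OF x_in_Y that, of d "c * c"] assms(2) c by (simp add: power2_eq_square)
  then have "tower_norm \<nu> x0 m (ev d) = tower_norm \<nu> x0 m (\<lambda>y. ev c y * ev c y)" by (rule tower_norm_cong)
  then have "of_rat r ^ 2 = (of_int i :: complex)"
    using assms(3) r by (simp add: tower_norm_mult power2_eq_square)
  then show ?thesis using rat_square_int that by metis
qed

text \<open>Two applications of \<open>K_square_mem\<close> descend to level \<open>m\<close>, where
  in each surviving case an explicit element is a square of known norm.\<close>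

lemma square_in_critical_orbit:
  assumes "s\<^sup>2 = of_nat \<nu> - x (Suc m)" "s \<in> K (Suc (Suc m))" "m \<ge> 1"
  defines "a \<equiv> \<lambda>m. ((\<lambda>z. z\<^sup>2 - int \<nu>) ^^ m) 0"
  shows "\<exists>k. a (m + 2) - int x0 = k\<^sup>2 \<or> (a (m + 2) - int x0) * (a (m + 1) - int x0) = k\<^sup>2"
proof -
  define n where "n = Suc m"
  have "s\<^sup>2 \<in> K n" unfolding assms(1) n_def by (intro K_closed)
  then consider "s \<in> K n" | b where "b \<in> K n" "s = b * x (Suc n)"
    using K_square_mem assms(2) n_def by blast
  then show ?thesis
  proof cases
    case 1
    then obtain c where c: "s = ev c (x n)" by (rule K_E)
    \<comment> \<open>Conjugating \<open>x n\<close> to \<open>- x n\<close> turns a square root of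
      \<nu> - x n into one of \<nu> + x n, which is x(n+1) up to sign.\<close>
    have "ev ([:of_nat \<nu>, -1:]) (x n) = ev (c\<^sup>2) (x n)" using assms(1) c n_def by simp
    then have "ev ([:of_nat \<nu>, -1:]) (- x n) = ev (c\<^sup>2) (- x n)"
      using transport_eq x_in_Y Y_uminus unfolding n_def by blast
    then have "(ev c (- x n))\<^sup>2 = (x (Suc n))\<^sup>2" by (simp add: x_Suc)
    then have "x (Suc n) = ev c (- x n) \<or> x (Suc n) = - ev c (- x n)"
      unfolding power2_eq_iff by auto
    then show ?thesis using x_Suc_notin K_ev K_uminus K_x by metis
  next
    case (2 b)
    \<comment> \<open>This factor makes e^2 = (\<nu> - x n)(\<nu> + x n), which lies one level
      further down.\<close>
    define e where "e = b * (of_nat \<nu> + x n)"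
    have "e\<^sup>2 = s\<^sup>2 * (of_nat \<nu> + x n)" unfolding e_def 2(2) power_mult_distrib x_Suc
      by (simp add: power2_eq_square)
    then have "e\<^sup>2 = of_nat \<nu> ^ 2 - (x n)\<^sup>2" unfolding assms(1) n_def
      by (simp add: power2_eq_square algebra_simps)
    then have e2: "e\<^sup>2 = of_nat \<nu> ^ 2 - of_nat \<nu> - x m" unfolding n_def x_Suc by simp
    have "e \<in> K (Suc m)" unfolding e_def using 2(1) n_def by (intro K_closed) (auto intro: K_x)
    moreover have "e\<^sup>2 \<in> K m" unfolding e2 by (intro K_closed)
    ultimately consider "e \<in> K m" | d where "d \<in> K m" "e = d * x (Suc m)"
      using K_square_mem by blast
    moreover
    \<comment> \<open>\<nu>^2 - \<nu> and -\<nu> are the second and first iterates of 0.\<close>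
    have a2: "((\<lambda>z. z\<^sup>2 - int \<nu>) ^^ m) (int \<nu> ^ 2 - int \<nu>) = a (m + 2)"
      unfolding a_def funpow_add by (simp add: numeral_2_eq_2)
    have a1: "((\<lambda>z. z\<^sup>2 - int \<nu>) ^^ m) (- int \<nu>) = a (m + 1)"
      unfolding a_def funpow_add by simp
    have N2: "tower_norm \<nu> x0 m (\<lambda>y. of_nat \<nu> ^ 2 - of_nat \<nu> - y) = of_int (a (m + 2) - int x0)"
      using tower_norm_linear[of \<nu> x0 m "of_int (int \<nu> ^ 2 - int \<nu>)"]
      unfolding funpow_of_int a2 by simp
    have N1: "tower_norm \<nu> x0 m (\<lambda>y. of_nat \<nu> + y) = of_int (a (m + 1) - int x0)"
      using tower_norm_linear'[of m \<nu> x0 "of_int (- int \<nu>)"] assms(3)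
      unfolding funpow_of_int a1 by (simp add: add.commute)
    ultimately show ?thesis
    proof cases
      case 1
      have d: "ev [:of_nat \<nu> ^ 2 - of_nat \<nu>, -1:] y = of_nat \<nu> ^ 2 - of_nat \<nu> - y" for y
        by (simp add: of_rat_diff of_rat_power)
      show ?thesis using norm_of_square[OF 1, of "[:of_nat \<nu> ^ 2 - of_nat \<nu>, -1:]"] N2
        unfolding d e2 by blast
    next
      case (2 d)
      define t where "t = d * (of_nat \<nu> + x m)"
      have t: "t \<in> K m" unfolding t_def using 2(1) by (intro K_closed)
      have "t\<^sup>2 = e\<^sup>2 * (of_nat \<nu> + x m)" unfolding t_def 2(2) power_mult_distrib x_Suc
        by (simp add: power2_eq_square)
      then have t2: "t\<^sup>2 = (of_nat \<nu> ^ 2 - of_nat \<nu> - x m) * (of_nat \<nu> + x m)" unfolding e2 .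
      have d: "ev ([:of_nat \<nu> ^ 2 - of_nat \<nu>, -1:] * [:of_nat \<nu>, 1:]) y
        = (of_nat \<nu> ^ 2 - of_nat \<nu> - y) * (of_nat \<nu> + y)" for y
        unfolding rat.ev_mult by (simp add: of_rat_diff of_rat_power)
      show ?thesis
        using norm_of_square[OF t, of "[:of_nat \<nu> ^ 2 - of_nat \<nu>, -1:] * [:of_nat \<nu>, 1:]"
          "(a (m + 2) - int x0) * (a (m + 1) - int x0)"] N1 N2
        unfolding d t2 tower_norm_mult by (metis of_int_mult)
    qed
  qed
qed

text \<open>For n >= 1 the element \<open>s\<close> is a value above the conjugate
  \<open>- x n\<close>, so g(s) = A(- x n) + s B(- x n) with a nonzero last factor, and this is
  solved for \<open>s\<close>.\<close>

lemma conjugate_root_mem: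
  assumes "ev g (x (Suc n)) \<notin> K n" "\<And>z. z \<in> Y (Suc n) \<Longrightarrow> ev g z \<in> K (Suc n)" "n \<ge> 1"
    and s: "s\<^sup>2 = of_nat \<nu> - x n"
  shows "s \<in> K (Suc n)"
proof -
  obtain A B where AB: "\<And>z. ev g z = ev A (z\<^sup>2 - of_nat \<nu>) + z * ev B (z\<^sup>2 - of_nat \<nu>)"
    using ev_even_odd_decomposition by blast
  obtain m where n: "n = Suc m" using assms(3) by (cases n) auto
  have mx: "- x n \<in> Y n" using x_in_Y[of n] unfolding n by (rule Y_uminus)
  have "ev B (x n) \<noteq> 0"
  proof
    assume "ev B (x n) = 0"
    then have "ev g (x (Suc n)) = ev A (x n)" using AB[of "x (Suc n)"] x_pred by simp
    then show False using assms(1) K_I by simp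
  qed
  then have B: "ev B (- x n) \<noteq> 0" using transport[OF mx x_in_Y] by blast
  have sn: "s\<^sup>2 - of_nat \<nu> = - x n" using s by simp
  then have "s \<in> Y (Suc n)" using mx by simp
  then have "ev g s \<in> K (Suc n)" by (rule assms(2))
  moreover have "s = (ev g s - ev A (- x n)) / ev B (- x n)" using AB[of s] B unfolding sn by simp
  moreover have "- x n \<in> K (Suc n)" using K_uminus K_x K_Suc by blast
  ultimately show ?thesis by (metis K_divide K_diff K_ev)
qed

end

subsection \<open>Finiteness of the set of integers with conjugates between 0 and 4\<close>

interpretation rat_vs: vector_space "\<lambda>(q :: rat) (z :: complex). of_rat q * z"
  by standard (auto simp: algebra_simps of_rat_add of_rat_mult)

lemma conj_in_interval_4D:
  assumes "a \<in> conj_in_interval R 4" "b \<in> conjugates a"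
  shows "b \<in> \<real>" "0 < Re b" "Re b < 4"
proof -
  show "b \<in> \<real>" "0 < Re b" using assms by (auto simp: conj_in_interval_def)
  have "ereal (Re b) < ereal 4" using assms by (simp add: conj_in_interval_def)
  then show "Re b < 4" by (simp only: less_ereal.simps)
qed

context sqrt_tower
begin

text \<open>Adjoining the multiples by x(n+1) at most doubles a spanning set; this bounds the degree
  over the rationals.\<close>

lemma K_subset_span: "\<exists>S. finite S \<and> card S \<le> 2 ^ n \<and> K n \<subseteq> rat_vs.span S"
proof (induction n)
  case 0
  have "K 0 \<subseteq> rat_vs.span {1}"
  proof
    fix a assume "a \<in> K 0"
    then obtain r where "a = of_rat r * 1" unfolding K_0 by auto
    then show "a \<in> rat_vs.span {1}" using rat_vs.span_scale[OF rat_vs.span_base[of 1 "{1}"], of r] by simp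
  qed
  then show ?case by (intro exI[of _ "{1}"]) auto
next
  case (Suc n)
  then obtain S where S: "finite S" "card S \<le> 2 ^ n" "K n \<subseteq> rat_vs.span S" by blast
  define T where "T = S \<union> (\<lambda>b. b * x (Suc n)) ` S"
  have times: "b * x (Suc n) \<in> rat_vs.span T" if "b \<in> rat_vs.span S" for b
    using that
  proof (induction rule: rat_vs.span_induct_alt)
    case base
    show ?case by (simp add: rat_vs.span_zero)
  next
    case (step c v w)
    have "of_rat c * (v * x (Suc n)) + w * x (Suc n) \<in> rat_vs.span T"
      using step by (intro rat_vs.span_add rat_vs.span_scale) (auto simp: T_def intro: rat_vs.span_base)
    then show ?case by (simp add: algebra_simps)
  qed
  have "K (Suc n) \<subseteq> rat_vs.span T"
  proof
    fix e assume "e \<in> K (Suc n)"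
    then obtain a b where ab: "a \<in> K n" "b \<in> K n" "e = a + b * x (Suc n)" using K_Suc_iff by blast
    have "a \<in> rat_vs.span T" using ab S rat_vs.span_mono[of S T] T_def by blast
    then show "e \<in> rat_vs.span T" unfolding ab(3) using times ab S by (intro rat_vs.span_add) auto
  qed
  moreover have "card T \<le> 2 ^ Suc n"
  proof -
    have "card T \<le> card S + card ((\<lambda>b. b * x (Suc n)) ` S)" unfolding T_def by (rule card_Un_le)
    also have "\<dots> \<le> 2 ^ n + 2 ^ n" using S card_image_le[OF S(1)] by (intro add_mono) (auto intro: le_trans)
    finally show ?thesis by simp
  qed
  moreover have "finite T" using S T_def by simp
  ultimately show ?case by blast
qed

text \<open>The powers of \<open>a\<close> up to exponent 2^n are linearly dependent. Dependence
  concerns sets, so coinciding powers are treated separately.\<close>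

lemma degree_bound:
  assumes "a \<in> K n"
  obtains p :: "rat poly" where "p \<noteq> 0" "degree p \<le> 2 ^ n" "ev p a = 0"
proof (cases "inj_on (\<lambda>i. a ^ i) {..2 ^ n}")
  case False
  then obtain i j where ij: "i \<le> 2 ^ n" "j \<le> 2 ^ n" "i \<noteq> j" "a ^ i = a ^ j" by (auto simp: inj_on_def)
  show ?thesis
  proof (rule that[of "monom 1 i - monom 1 j"])
    show "monom 1 i - monom 1 j \<noteq> (0 :: rat poly)"
      using ij(3) by (metis diff_eq_diff_eq degree_monom_eq diff_self zero_neq_one)
    show "degree (monom 1 i - monom 1 j :: rat poly) \<le> 2 ^ n"
      using ij by (intro degree_diff_le) (auto intro: degree_monom_le le_trans)
    show "ev (monom 1 i - monom 1 j) a = 0" using ij(4) by (simp add: rat.ev_monom)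
  qed
next
  case True
  define P where "P = (\<lambda>i. a ^ i) ` {..(2::nat) ^ n}"
  obtain S where S: "finite S" "card S \<le> 2 ^ n" "K n \<subseteq> rat_vs.span S" using K_subset_span by blast
  have "card P = 2 ^ n + 1" unfolding P_def using True by (simp add: card_image)
  moreover have "P \<subseteq> rat_vs.span S" unfolding P_def using S(3) K_power[OF assms] by blast
  ultimately have "rat_vs.dependent P" using rat_vs.independent_span_bound[OF S(1), of P] S(2) by force
  moreover have "finite P" unfolding P_def by simp
  ultimately obtain u where u: "\<exists>v\<in>P. u v \<noteq> 0" "(\<Sum>v\<in>P. of_rat (u v) * v) = 0"
    using rat_vs.dependent_finite by blast
  then obtain k where k: "k \<le> 2 ^ n" "u (a ^ k) \<noteq> 0" unfolding P_def by auto
  define p where "p = (\<Sum>i\<le>2 ^ n. monom (u (a ^ i)) i)"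
  show ?thesis
  proof (rule that[of p])
    have "coeff p k = u (a ^ k)" unfolding p_def using k(1) by (simp add: coeff_sum)
    then show "p \<noteq> 0" using k(2) by auto
    show "degree p \<le> 2 ^ n" unfolding p_def
      by (rule degree_sum_le) (auto intro: degree_monom_le le_trans)
    have "ev p a = (\<Sum>i\<le>2 ^ n. of_rat (u (a ^ i)) * a ^ i)"
      unfolding p_def by (simp add: rat.ev_sum rat.ev_monom)
    also have "\<dots> = (\<Sum>v\<in>P. of_rat (u v) * v)" unfolding P_def using True by (simp add: sum.reindex)
    finally show "ev p a = 0" using u(2) by simp
  qed
qed

text \<open>By Kronecker, \<alpha> - 2 is a root of some \<open>C\<close> all of whose roots are
  polynomials in \<alpha> - 2, and transport makes \<open>ev g z - 2\<close> a root of
  \<open>C\<close> too.\<close>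

lemma conjugate_mem:
  assumes "ev g (x n) \<in> conj_in_interval (ring_of_integers (K n)) 4" "z \<in> Y n"
  shows "ev g z \<in> K n"
proof -
  define \<alpha> where "\<alpha> = ev g (x n)"
  have a: "algebraic_int \<alpha>" "\<And>b. b \<in> conjugates \<alpha> \<Longrightarrow> b \<in> \<real> \<and> 0 < Re b \<and> Re b < 4"
    using assms(1) conj_in_interval_4D[OF assms(1)] unfolding \<alpha>_def
    by (auto simp: conj_in_interval_def ring_of_integers_def)
  obtain q where q: "lead_coeff q = 1" "evi q \<alpha> = 0"
    "Factorial_Ring.irreducible (map_poly of_int q :: rat poly)"
    using algebraic_int_minpoly[OF a(1)] by blast
  define Q where "Q = q \<circ>\<^sub>p [:2, 1:]"
  have "lead_coeff Q = 1" unfolding Q_def using q(1) lead_coeff_comp[of "[:2, 1:]" q] by simp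
  moreover have evQ: "evi Q w = evi q (w + 2)" for w unfolding Q_def by (simp add: add.commute)
  have "evi Q (\<alpha> - 2) = 0" using q(2) evQ by simp
  moreover have "w \<in> \<real> \<and> \<bar>Re w\<bar> \<le> 2" if "evi Q w = 0" for w
  proof -
    have "w + 2 \<in> conjugates \<alpha>"
      unfolding conjugates_def using q that evQ by (auto simp: ev_of_int_poly intro!: exI[of _ "map_poly of_int q"])
    then have w: "w + 2 \<in> \<real>" "0 < Re (w + 2)" "Re (w + 2) < 4" using a(2) by blast+
    have "w + 2 - 2 \<in> \<real>" using w(1) by (intro Reals_diff Reals_numeral)
    then show ?thesis using w(2,3) by (simp add: abs_le_iff)
  qed
  ultimately obtain i j where "i < j"
    "((\<lambda>z. z\<^sup>2 - 2) ^^ i) (\<alpha> - 2) = ((\<lambda>z. z\<^sup>2 - 2) ^^ j) (\<alpha> - 2)"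
    using orbit_not_injective by blast
  then obtain C where C: "ev C (\<alpha> - 2) = 0" "\<And>\<beta>. ev C \<beta> = 0 \<Longrightarrow> \<exists>P. \<beta> = ev P (\<alpha> - 2)"
    using preperiodic_imp_normal by blast
  have "ev (C \<circ>\<^sub>p (g - [:2:])) (x n) = 0" using C(1) unfolding \<alpha>_def by simp
  then have "ev (C \<circ>\<^sub>p (g - [:2:])) z = 0" using transport[OF x_in_Y assms(2)] by blast
  then obtain P where P: "ev g z - 2 = ev P (\<alpha> - 2)" using C(2)[of "ev g z - 2"] by auto
  have "ev P (\<alpha> - 2) + 2 \<in> K n" unfolding \<alpha>_def by (intro K_add K_ev K_diff K_I K_numerals)
  then show ?thesis unfolding P[symmetric] by simp
qed

lemma finite_conj_in_interval_4:
  assumes "\<nu> \<ge> 3"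
  shows "finite (conj_in_interval (ring_of_integers (\<Union>n. K n)) 4)" (is "finite ?O")
proof -
  obtain N where N: "\<And>m k. m \<ge> N \<Longrightarrow> ((\<lambda>z. z\<^sup>2 - int \<nu>) ^^ (m + 2)) 0 - int x0 \<noteq> k\<^sup>2"
    "\<And>m k. m \<ge> N \<Longrightarrow> (((\<lambda>z. z\<^sup>2 - int \<nu>) ^^ (m + 2)) 0 - int x0) *
      (((\<lambda>z. z\<^sup>2 - int \<nu>) ^^ (m + 1)) 0 - int x0) \<noteq> k\<^sup>2"
    using critical_orbit_eventually_not_square[OF assms] by metis
  \<comment> \<open>The descent needs m >= 1 and m >= N; its lowest case m = \<open>Suc N\<close>
    ends in \<open>K (Suc (Suc N))\<close>.\<close>
  define M where "M = Suc (Suc N)"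
  have step: "\<alpha> \<in> K (Suc m)" if m: "m \<ge> Suc N" and \<alpha>: "\<alpha> \<in> K (Suc (Suc m))" "\<alpha> \<in> ?O" for m \<alpha>
  proof (rule ccontr)
    assume nin: "\<alpha> \<notin> K (Suc m)"
    obtain g where g: "\<alpha> = ev g (x (Suc (Suc m)))" using \<alpha>(1) by (rule K_E)
    have "\<alpha> \<in> conj_in_interval (ring_of_integers (K (Suc (Suc m)))) 4"
      using \<alpha> by (auto simp: conj_in_interval_def ring_of_integers_def)
    then have gz: "ev g z \<in> K (Suc (Suc m))" if "z \<in> Y (Suc (Suc m))" for z
      using conjugate_mem that unfolding g by blast
    define s where "s = csqrt (of_nat \<nu> - x (Suc m))"
    have s: "s\<^sup>2 = of_nat \<nu> - x (Suc m)" unfolding s_def by simp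
    have "s \<in> K (Suc (Suc m))"
      by (rule conjugate_root_mem[OF _ gz _ s]) (use nin g in auto)
    moreover have m': "m \<ge> 1" "m \<ge> N" using m by auto
    ultimately show False using square_in_critical_orbit[OF s] N[OF m'(2)] by blast
  qed
  have desc: "\<alpha> \<in> K (M + k) \<Longrightarrow> \<alpha> \<in> ?O \<Longrightarrow> \<alpha> \<in> K M" for k \<alpha>
  proof (induction k)
    case (Suc k)
    then show ?case using step[of "Suc N + k" \<alpha>] unfolding M_def by auto
  qed simp
  have mem: "\<alpha> \<in> K M" if O: "\<alpha> \<in> ?O" for \<alpha>
  proof -
    obtain n where "\<alpha> \<in> K n" using O by (auto simp: conj_in_interval_def ring_of_integers_def)
    then have "\<alpha> \<in> K (M + n)" using K_mono[of n "M + n"] by auto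
    then show ?thesis using desc O by blast
  qed
  \<comment> \<open>Inside \<open>K M\<close> degrees are at most 2^M and conjugates are bounded by
    4, which leaves finitely many minimal polynomials.\<close>
  have "?O \<subseteq> {a. \<exists>q :: int poly. lead_coeff q = 1 \<and> degree q \<le> 2 ^ M \<and> evi q a = 0 \<and>
    (\<forall>z. evi q z = 0 \<longrightarrow> norm z \<le> 4)}"
  proof
    fix \<alpha> assume O: "\<alpha> \<in> ?O"
    then have "algebraic_int \<alpha>" by (auto simp: conj_in_interval_def ring_of_integers_def)
    then obtain q where q: "lead_coeff q = 1" "evi q \<alpha> = 0"
      "Factorial_Ring.irreducible (map_poly of_int q :: rat poly)"
      by (rule algebraic_int_minpoly)
    obtain p :: "rat poly" where p: "p \<noteq> 0" "degree p \<le> 2 ^ M" "ev p \<alpha> = 0"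
      using degree_bound[OF mem[OF O]] by blast
    have "map_poly of_int q dvd p"
      using irreducible_dvd_if_common_root[OF q(3)] q(2) p(3) ev_of_int_poly by metis
    then have "degree (map_poly of_int q :: rat poly) \<le> degree p" using p(1) by (rule dvd_imp_degree_le)
    then have "degree q \<le> 2 ^ M" using p(2) by (simp add: degree_map_poly)
    moreover have "norm z \<le> 4" if "evi q z = 0" for z
    proof -
      have "z \<in> conjugates \<alpha>"
        unfolding conjugates_def using q that by (auto simp: ev_of_int_poly intro!: exI[of _ "map_poly of_int q"])
      then have "z \<in> \<real>" "0 < Re z" "Re z < 4" using conj_in_interval_4D[OF O] by auto
      then show ?thesis by (auto elim!: Reals_cases)
    qed
    ultimately show "\<alpha> \<in> {a. \<exists>q :: int poly. lead_coeff q = 1 \<and> degree q \<le> 2 ^ M \<and> evi q a = 0 \<and>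
      (\<forall>z. evi q z = 0 \<longrightarrow> norm z \<le> 4)}" using q by blast
  qed
  then show ?thesis by (rule finite_subset) (rule finite_roots_monic_int_polys, simp)
qed

end

subsection \<open>The fields of the tower\<close>

lemmas complex_field_axioms = ring_from_type_algebra[where 'a = complex]
  cring_from_type_algebra[where 'a = complex] field_from_type_algebra[where 'a = complex]

lemma complex_field_simps:
  "carrier complex_field = UNIV" "\<one>\<^bsub>complex_field\<^esub> = 1" "\<zero>\<^bsub>complex_field\<^esub> = 0"
  "a \<otimes>\<^bsub>complex_field\<^esub> b = a * b" "a \<oplus>\<^bsub>complex_field\<^esub> b = a + b"
  by (simp_all add: ring_of_type_algebra_def)

lemma complex_field_uminus: "\<ominus>\<^bsub>complex_field\<^esub> a = - a"
  by (rule abelian_group.minus_equality[OF ring.is_abelian_group[OF complex_field_axioms(1)]]) (simp_all add: complex_field_simps)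

lemma complex_field_inv: "a \<noteq> 0 \<Longrightarrow> inv\<^bsub>complex_field\<^esub> a = inverse a"
  by (rule comm_monoid.comm_inv_char[OF cring.axioms(2)[OF complex_field_axioms(2)]]) (simp_all add: complex_field_simps)

lemma generate_field_closed:
  assumes "a \<in> generate_field complex_field H" "b \<in> generate_field complex_field H"
  shows "a + b \<in> generate_field complex_field H" "a * b \<in> generate_field complex_field H"
    "- a \<in> generate_field complex_field H" "inverse a \<in> generate_field complex_field H"
    "1 \<in> generate_field complex_field H" "0 \<in> generate_field complex_field H"
proof -
  note [simp] = complex_field_simps complex_field_uminus complex_field_inv
  show "a + b \<in> generate_field complex_field H" using generate_field.eng_add[OF assms] by simp
  show "a * b \<in> generate_field complex_field H" using generate_field.eng_mult[OF assms] by simp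
  show "- a \<in> generate_field complex_field H" using generate_field.a_inv[OF assms(1)] by simp
  show 0: "0 \<in> generate_field complex_field H" using field.zero_in_generate[OF complex_field_axioms(3), of H] by simp
  show "inverse a \<in> generate_field complex_field H"
    using generate_field.m_inv[OF assms(1)] 0 by (cases "a = 0") auto
  show "1 \<in> generate_field complex_field H" using generate_field.one[of complex_field H] by simp
qed

lemma of_rat_in_generate_field: "of_rat r \<in> generate_field complex_field H"
proof -
  have 01: "0 \<in> generate_field complex_field H" "1 \<in> generate_field complex_field H"
    using generate_field_closed[OF generate_field.one generate_field.one] by auto
  have nat: "of_nat n \<in> generate_field complex_field H" for n
    by (induction n) (auto intro!: generate_field_closed 01)
  have int: "of_int i \<in> generate_field complex_field H" for i
    by (cases i rule: int_cases2) (auto intro!: generate_field_closed(3) nat)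
  obtain m n where "quotient_of r = (m, n)" by (cases "quotient_of r")
  then have "r = of_int m / of_int n" by (rule quotient_of_div)
  then have "of_rat r = of_int m * inverse (of_int n :: complex)" by (simp add: divide_inverse of_rat_mult of_rat_inverse)
  then show ?thesis using generate_field_closed(2)[OF int generate_field_closed(4)[OF int int]] by simp
qed

lemma ev_in_generate_field: "ev p a \<in> generate_field complex_field {a}"
proof (induction p)
  case 0
  show ?case using of_rat_in_generate_field[of 0] by simp
next
  case (pCons c p)
  have "a \<in> generate_field complex_field {a}" by (rule generate_field.incl) simp
  then show ?case using pCons of_rat_in_generate_field by (simp add: generate_field_closed)
qed

lemma (in sqrt_tower) tower_field_eq: "tower_field x n = K n"
proof
  show "K n \<subseteq> tower_field x n" using ev_in_generate_field by (auto simp: K_def tower_field_def)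
  show "tower_field x n \<subseteq> K n"
  proof
    fix a assume "a \<in> tower_field x n"
    then have "a \<in> generate_field complex_field {x n}" by (simp add: tower_field_def)
    then show "a \<in> K n"
      by (induction rule: generate_field.induct)
        (auto simp: complex_field_simps complex_field_uminus complex_field_inv K_closed K_inverse)
  qed
qed

lemma (in sqrt_tower) tower_union_eq: "tower_union x = (\<Union>n. K n)"
  by (simp add: tower_union_def tower_field_eq)

lemma sqrt_seq_square:
  assumes "sqrt_seq \<nu> x0 x"
  shows "(x (Suc n))\<^sup>2 = of_nat \<nu> + x n"
proof -
  have "x (Suc n) = csqrt (of_nat \<nu> + x n) \<or> x (Suc n) = - csqrt (of_nat \<nu> + x n)"
    using assms by (simp add: sqrt_seq_def)
  then show ?thesis by (metis power2_csqrt power2_minus)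
qed

lemma sqrt_seq_in_tower_values:
  assumes "sqrt_seq \<nu> x0 x"
  shows "x n \<in> tower_values \<nu> x0 n"
  using assms by (induction n) (auto simp: sqrt_seq_square[OF assms] sqrt_seq_def)

text \<open>\<open>x n\<close> is a polynomial in x(n+1); were the converse true, the two fields
  would coincide and the dimension would be both 1 and 2.\<close>

lemma sqrt_tower_if_dimension:
  assumes seq: "sqrt_seq \<nu> x0 x"
    and dim: "\<And>n. ring.dimension complex_field 2 (tower_field x n) (tower_field x (Suc n))"
  shows "sqrt_tower \<nu> x0 x"
proof
  show "x 0 = of_nat x0" using seq by (simp add: sqrt_seq_def)
  fix n
  show sq: "(x (Suc n))\<^sup>2 = of_nat \<nu> + x n" by (rule sqrt_seq_square[OF seq])
  have sub: "subfield (tower_field x k) complex_field" for k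
    unfolding tower_field_def by (rule field.generate_field_is_subfield[OF complex_field_axioms(3)]) (simp add: complex_field_simps)
  have min: "tower_field x k \<subseteq> tower_field x l" if "x k \<in> tower_field x l" for k l
    unfolding tower_field_def[of x k]
    by (rule field.generate_field_min_subfield1[OF complex_field_axioms(3)]) (use sub that in \<open>auto simp: complex_field_simps\<close>)
  show "x (Suc n) \<notin> range (\<lambda>p. ev p (x n))"
  proof
    assume "x (Suc n) \<in> range (\<lambda>p. ev p (x n))"
    then have "x (Suc n) \<in> tower_field x n" using ev_in_generate_field by (auto simp: tower_field_def)
    moreover have "x n = ev [:- of_nat \<nu>, 0, 1:] (x (Suc n))" using sq by (simp add: power2_eq_square)
    then have "x n \<in> tower_field x (Suc n)" using ev_in_generate_field by (simp only: tower_field_def)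
    ultimately have "tower_field x (Suc n) = tower_field x n" using min by blast
    then have "ring.dimension complex_field 2 (tower_field x n) (tower_field x n)" using dim by metis
    then have "2 = (1 :: nat)" using ring.dimension_is_inj[OF complex_field_axioms(1) sub]
      ring.dimension_one[OF complex_field_axioms(1) sub] by blast
    then show False by simp
  qed
qed

section \<open>Change of signs, real values and an upper bound for the infimum\<close>

context sqrt_tower
begin

text \<open>The sequence supplied by \<open>Omega\<close> may differ in signs from the given one; a
  polynomial relation for \<open>z\<close> would transport to \<open>x\<close>.\<close>

lemma sqrt_tower_other_signs:
  assumes "sqrt_seq \<nu> x0 z"
  shows "sqrt_tower \<nu> x0 z"
proof
  show "z 0 = of_nat x0" using assms by (simp add: sqrt_seq_def)
  fix n
  show "(z (Suc n))\<^sup>2 = of_nat \<nu> + z n" by (rule sqrt_seq_square[OF assms])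
  show "z (Suc n) \<notin> range (\<lambda>p. ev p (z n))"
  proof
    assume "z (Suc n) \<in> range (\<lambda>p. ev p (z n))"
    then obtain p where p: "z (Suc n) = ev p (z n)" by blast
    have "ev (p\<^sup>2) (z n) = ev [:of_nat \<nu>, 1:] (z n)"
      using sqrt_seq_square[OF assms, of n] by (simp add: p)
    then have "ev (p\<^sup>2) (x n) = ev [:of_nat \<nu>, 1:] (x n)"
      using transport_eq sqrt_seq_in_tower_values[OF assms] x_in_Y by blast
    then have "(ev p (x n))\<^sup>2 = (x (Suc n))\<^sup>2" by (simp add: x_Suc)
    then have "x (Suc n) = ev p (x n) \<or> x (Suc n) = - ev p (x n)" unfolding power2_eq_iff by auto
    then show False using x_Suc_notin K_I K_uminus by metis
  qed
qed

text \<open>Below level \<open>n\<close> the branch is forced; above it, principal square roots are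
  taken.\<close>

lemma extend_value:
  assumes "y \<in> Y n"
  obtains v where "v n = y" "\<And>m. v m \<in> Y m" "\<And>m. (v (Suc m))\<^sup>2 - of_nat \<nu> = v m"
proof -
  have up: "((\<lambda>w. csqrt (of_nat \<nu> + w)) ^^ k) y \<in> Y (n + k)" if "y \<in> Y n" for y n k
    using that by (induction k) auto
  have "\<exists>v. v n = y \<and> (\<forall>m. v m \<in> Y m) \<and> (\<forall>m. (v (Suc m))\<^sup>2 - of_nat \<nu> = v m)"
    using assms
  proof (induction n arbitrary: y)
    case 0
    show ?case
      by (rule exI[of _ "\<lambda>m. ((\<lambda>w. csqrt (of_nat \<nu> + w)) ^^ m) y"]) (use up[OF 0] in auto)
  next
    case (Suc n)
    then have "y\<^sup>2 - of_nat \<nu> \<in> Y n" by simp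
    from Suc.IH[OF this] obtain v where v: "v n = y\<^sup>2 - of_nat \<nu>" "\<And>m. v m \<in> Y m"
      "\<And>m. (v (Suc m))\<^sup>2 - of_nat \<nu> = v m" by blast
    define v' where "v' = (\<lambda>m. if m \<le> n then v m else ((\<lambda>w. csqrt (of_nat \<nu> + w)) ^^ (m - Suc n)) y)"
    have "v' (Suc n) = y" by (simp add: v'_def)
    moreover have "v' m \<in> Y m" for m
    proof (cases "m \<le> n")
      case False
      then have "Suc n + (m - Suc n) = m" by simp
      then show ?thesis using up[OF Suc.prems, of "m - Suc n"] False unfolding v'_def by metis
    qed (simp add: v'_def v(2))
    moreover have "(v' (Suc m))\<^sup>2 - of_nat \<nu> = v' m" for m
    proof -
      consider "Suc m \<le> n" | "m = n" | k where "m = Suc n + k"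
        by (metis le_Suc_ex not_less_eq_eq le_antisym)
      then show ?thesis by cases (auto simp: v'_def v)
    qed
    ultimately show ?case by blast
  qed
  then show ?thesis using that by blast
qed

text \<open>A branch \<open>v\<close> of values through \<open>y\<close> gives the embedding \<open>p(x m) \<mapsto> p(v m)\<close> of the whole field.\<close>

lemma values_real:
  assumes "totally_real_field (tower_union x)" "y \<in> Y n"
  shows "y \<in> \<real>"
proof -
  obtain v where v: "v n = y" "\<And>m. v m \<in> Y m" "\<And>m. (v (Suc m))\<^sup>2 - of_nat \<nu> = v m"
    using extend_value[OF assms(2)] by blast
  \<comment> \<open>Two expressions can be rewritten at a common level, where
    \<open>transport_eq\<close> shows that the map is well defined.\<close>
  have lift: "\<exists>q. ev p (x m) = ev q (x (m + k)) \<and> ev p (v m) = ev q (v (m + k))" for p m k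
  proof (induction k)
    case (Suc k)
    then obtain q where q: "ev p (x m) = ev q (x (m + k))" "ev p (v m) = ev q (v (m + k))" by blast
    have "ev q (w\<^sup>2 - of_nat \<nu>) = ev (q \<circ>\<^sub>p [:- of_nat \<nu>, 0, 1:]) w" for w
      by (simp add: power2_eq_square)
    from this[of "x (Suc (m + k))"] this[of "v (Suc (m + k))"]
    show ?case using q unfolding x_pred v(3) by (intro exI[of _ "q \<circ>\<^sub>p [:- of_nat \<nu>, 0, 1:]"]) auto
  qed auto
  define \<sigma> where "\<sigma> a = (THE b. \<exists>m p. a = ev p (x m) \<and> b = ev p (v m))" for a
  have \<sigma>: "\<sigma> (ev p (x m)) = ev p (v m)" for p m
    unfolding \<sigma>_def
  proof (rule the_equality)
    fix b assume "\<exists>m' q. ev p (x m) = ev q (x m') \<and> b = ev q (v m')"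
    then obtain m' q where q: "ev p (x m) = ev q (x m')" "b = ev q (v m')" by blast
    obtain p' where p': "ev p (x m) = ev p' (x (m + m'))" "ev p (v m) = ev p' (v (m + m'))"
      using lift by blast
    obtain q' where q': "ev q (x m') = ev q' (x (m' + m))" "ev q (v m') = ev q' (v (m' + m))"
      using lift by blast
    show "b = ev p (v m)"
      using transport_eq[OF x_in_Y v(2), of "p'" "m + m'" q'] p' q' q by (simp add: add.commute)
  qed blast
  have common: "\<exists>M p q. a = ev p (x M) \<and> b = ev q (x M)" if ab: "a \<in> tower_union x" "b \<in> tower_union x" for a b
  proof -
    obtain k l where "a \<in> K k" "b \<in> K l" using ab unfolding tower_union_eq by blast
    then have "a \<in> K (max k l)" "b \<in> K (max k l)" using K_mono[of k "max k l"] K_mono[of l "max k l"] by auto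
    then show ?thesis by (metis K_E)
  qed
  have "\<sigma> \<in> ring_hom (complex_field\<lparr>carrier := tower_union x\<rparr>) complex_field"
  proof (rule ring_hom_memI)
    fix a b assume "a \<in> carrier (complex_field\<lparr>carrier := tower_union x\<rparr>)"
      "b \<in> carrier (complex_field\<lparr>carrier := tower_union x\<rparr>)"
    then obtain M p q where pq: "a = ev p (x M)" "b = ev q (x M)" using common by (metis partial_object.select_convs(1) partial_object.surjective partial_object.update_convs(1))
    have "\<sigma> (a * b) = \<sigma> a * \<sigma> b" "\<sigma> (a + b) = \<sigma> a + \<sigma> b"
      unfolding pq \<sigma> rat.ev_mult[symmetric] rat.ev_add[symmetric] by simp_all
    then show "\<sigma> (a \<otimes>\<^bsub>complex_field\<lparr>carrier := tower_union x\<rparr>\<^esub> b) = \<sigma> a \<otimes>\<^bsub>complex_field\<^esub> \<sigma> b"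
      "\<sigma> (a \<oplus>\<^bsub>complex_field\<lparr>carrier := tower_union x\<rparr>\<^esub> b) = \<sigma> a \<oplus>\<^bsub>complex_field\<^esub> \<sigma> b"
      by (simp_all add: ring_of_type_algebra_def)
  next
    show "\<sigma> \<one>\<^bsub>complex_field\<lparr>carrier := tower_union x\<rparr>\<^esub> = \<one>\<^bsub>complex_field\<^esub>"
      using \<sigma>[of 1 0] by (simp add: ring_of_type_algebra_def)
  qed (simp add: ring_of_type_algebra_def)
  then have "\<sigma> ` tower_union x \<subseteq> \<real>" using assms(1) by (auto simp: totally_real_field_def)
  moreover have "\<sigma> (x n) = y" using \<sigma>[of "[:0, 1:]" n] v(1) by simp
  moreover have "x n \<in> tower_union x" using K_x unfolding tower_union_eq by blast
  ultimately show ?thesis by blast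
qed

text \<open>The bound B reproduces itself because \<nu> + B <= 2 B <= B^2.\<close>

lemma values_norm_le: "y \<in> Y n \<Longrightarrow> norm y \<le> real (\<nu> + x0 + 2)"
proof (induction n arbitrary: y)
  case (Suc n)
  define B where "B = real (\<nu> + x0 + 2)"
  have "norm (y\<^sup>2 - of_nat \<nu>) \<le> B" using Suc unfolding B_def by simp
  then have "norm (y\<^sup>2) \<le> real \<nu> + B"
    using norm_triangle_ineq[of "y\<^sup>2 - of_nat \<nu>" "of_nat \<nu>"] by (simp add: norm_of_nat)
  also have "\<dots> \<le> 2 * B" unfolding B_def by simp
  also have "\<dots> \<le> B * B" unfolding B_def by (intro mult_right_mono) auto
  finally have "(norm y)\<^sup>2 \<le> B\<^sup>2" by (simp add: norm_mult power2_eq_square)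
  then show ?case unfolding B_def by (rule power2_le_imp_le) simp
qed auto

lemma values_roots:
  obtains G :: "int poly" where "lead_coeff G = 1" "\<And>z. evi G z = 0 \<longleftrightarrow> z \<in> Y n"
proof -
  have "\<exists>G :: int poly. lead_coeff G = 1 \<and> (\<forall>z. evi G z = 0 \<longleftrightarrow> z \<in> Y n)"
  proof (induction n)
    case 0
    show ?case by (rule exI[of _ "[:- int x0, 1:]"]) (auto simp: add_eq_0_iff)
  next
    case (Suc n)
    then obtain G :: "int poly" where "lead_coeff G = 1" "\<forall>z. evi G z = 0 \<longleftrightarrow> z \<in> Y n" by blast
    then show ?case using lead_coeff_comp[of "[:- int \<nu>, 0, 1:]" G]
      by (intro exI[of _ "G \<circ>\<^sub>p [:- int \<nu>, 0, 1:]"]) (simp add: power2_eq_square)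
  qed
  then show ?thesis using that by blast
qed

lemma inj_x: "inj x"
proof (rule linorder_injI)
  fix m n :: nat assume "m < n"
  then obtain k where k: "n = Suc k" "m \<le> k" by (cases n) auto
  have "x m \<in> K k" using K_x K_mono[OF k(2)] by blast
  then show "x m \<noteq> x n" using x_Suc_notin k(1) by metis
qed

lemma infinite_conj_in_interval:
  assumes "\<And>n. Y n \<subseteq> \<real>"
  shows "infinite (conj_in_interval (ring_of_integers (\<Union>n. K n)) (ereal (2 * real (\<nu> + x0 + 3))))"
proof -
  \<comment> \<open>This \<open>c\<close> exceeds the bound of \<open>values_norm_le\<close>, so the
    conjugates of x n + c lie between 0 and 2 c.\<close>
  define c where "c = \<nu> + x0 + 3"
  have "x n + of_nat c \<in> conj_in_interval (ring_of_integers (\<Union>n. K n)) (ereal (2 * real c))" for n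
  proof -
    obtain G :: "int poly" where G: "lead_coeff G = 1" "\<And>z. evi G z = 0 \<longleftrightarrow> z \<in> Y n"
      using values_roots[of n] by blast
    define H where "H = G \<circ>\<^sub>p [:- int c, 1:]"
    have evH: "evi H z = evi G (z - of_nat c)" for z unfolding H_def by simp
    have "lead_coeff H = 1" unfolding H_def using G(1) lead_coeff_comp[of "[:- int c, 1:]" G] by simp
    moreover have root: "evi H (x n + of_nat c) = 0" using G(2) evH x_in_Y by simp
    ultimately have "algebraic_int (x n + of_nat c)" unfolding algebraic_int_altdef_ipoly by blast
    moreover have "x n + of_nat c \<in> K n" by (intro K_closed)
    moreover have "b \<in> \<real> \<and> 0 < Re b \<and> ereal (Re b) < ereal (2 * real c)" if "b \<in> conjugates (x n + of_nat c)" for b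
    proof -
      have "evi H b = 0" using conjugates_imp_root[OF that, of "map_poly of_int H"] root by (simp add: ev_of_int_poly)
      then have y: "b - of_nat c \<in> Y n" using G(2) evH by simp
      then have "b - of_nat c \<in> \<real>" using assms by blast
      then have "b - of_nat c + of_nat c \<in> \<real>" by (intro Reals_add Reals_of_nat)
      moreover have "\<bar>Re (b - of_nat c)\<bar> < real c"
        using values_norm_le[OF y] abs_Re_le_cmod[of "b - of_nat c"] by (simp add: c_def)
      ultimately show ?thesis by (auto simp: abs_less_iff)
    qed
    ultimately show ?thesis by (auto simp: conj_in_interval_def ring_of_integers_def)
  qed
  then have "range (\<lambda>n. x n + of_nat c) \<subseteq> conj_in_interval (ring_of_integers (\<Union>n. K n)) (ereal (2 * real c))"
    by blast
  moreover have "infinite (range (\<lambda>n. x n + of_nat c))"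
    using inj_x by (auto simp: finite_image_iff inj_def)
  ultimately show ?thesis unfolding c_def using finite_subset by blast
qed

text \<open>Let \<nu> = 2. If x0 = 2, the next term is 2 or -2, hence rational. If x0 > 2, then r =
  sqrt(2 + x0) > 2, and the square root of 2 - r is a nonreal value.\<close>

lemma nu_ge_3:
  assumes "\<nu> \<ge> 2" "(\<nu>, x0) \<noteq> (2, 0)" "(\<nu>, x0) \<noteq> (2, 1)" "\<And>n. Y n \<subseteq> \<real>"
  shows "\<nu> \<ge> 3"
proof (rule ccontr)
  assume "\<not> \<nu> \<ge> 3"
  then have \<nu>: "\<nu> = 2" using assms(1) by simp
  then have "x0 \<ge> 2" using assms(2,3) by auto
  then consider "x0 = 2" | "x0 > 2" by linarith
  then show False
  proof cases
    case 1
    then have "(x (Suc 0))\<^sup>2 = 2\<^sup>2" using x_Suc[of 0] x_0 \<nu> by simp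
    then have "x (Suc 0) = 2 \<or> x (Suc 0) = - 2" unfolding power2_eq_iff .
    then show ?thesis using x_Suc_notin[of 0] K_numerals(4) K_uminus by metis
  next
    case 2
    define r where "r = sqrt (2 + real x0)"
    have r2: "r\<^sup>2 = 2 + real x0" unfolding r_def by simp
    have "sqrt (2\<^sup>2) < r" unfolding r_def using 2 by (intro real_sqrt_less_mono) simp
    then have r: "r > 2" by simp
    have "(complex_of_real r)\<^sup>2 = 2 + of_nat x0" using arg_cong[OF r2, of complex_of_real] by simp
    then have "- complex_of_real r \<in> Y 1" unfolding \<nu> by simp
    then have "csqrt (2 - complex_of_real r) \<in> Y (Suc 1)" unfolding \<nu> tower_values.simps(2) by simp
    then have "csqrt (2 - complex_of_real r) \<in> \<real>" using assms(4) by blast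
    then obtain t where "csqrt (2 - complex_of_real r) = of_real t" by (rule Reals_cases)
    then have "complex_of_real (2 - r) = of_real (t\<^sup>2)" by (metis of_real_diff of_real_numeral of_real_power power2_csqrt)
    then have "2 - r = t\<^sup>2" by (simp only: of_real_eq_iff)
    then show ?thesis using r zero_le_power2[of t] by linarith
  qed
qed

end

section \<open>Bounds for the JR-number\<close>

theorem theorem1p3:
  fixes \<nu> x0 :: nat and x :: "nat \<Rightarrow> complex"
  assumes "(\<nu>, x0) \<in> Omega"
    and "(\<nu>, x0) \<noteq> (2, 0)"
    and "(\<nu>, x0) \<noteq> (2, 1)"
    and "sqrt_seq \<nu> x0 x"
  shows "(JR_number (ring_of_integers (tower_union x)) = 4 \<and>
            \<not> JR_is_minimum (ring_of_integers (tower_union x))) \<or>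
         (4 < JR_number (ring_of_integers (tower_union x)) \<and>
            JR_number (ring_of_integers (tower_union x)) < \<infinity>)"
proof -
  obtain u where u: "\<nu> \<ge> 2" "sqrt_seq \<nu> x0 u"
    "\<And>n. ring.dimension complex_field 2 (tower_field u n) (tower_field u (Suc n))"
    "totally_real_field (tower_union u)"
    using assms(1) by (auto simp: Omega_def)
  interpret U: sqrt_tower \<nu> x0 u by (rule sqrt_tower_if_dimension[OF u(2,3)])
  have real: "tower_values \<nu> x0 n \<subseteq> \<real>" for n using U.values_real[OF u(4)] by blast
  have \<nu>: "\<nu> \<ge> 3" by (rule U.nu_ge_3[OF u(1) assms(2,3) real])
  interpret X: sqrt_tower \<nu> x0 x by (rule U.sqrt_tower_other_signs[OF assms(4)])
  define R where "R = ring_of_integers (tower_union x)"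
  have fin: "finite (conj_in_interval R 4)"
    unfolding R_def X.tower_union_eq by (rule X.finite_conj_in_interval_4[OF \<nu>])
  \<comment> \<open>Finiteness at 4 passes to all smaller \<open>t\<close>, so 4 is not in the set;
    if the infimum equals 4, it is not attained.\<close>
  have gt: "4 < t" if "t \<in> JR_set R" for t
  proof (rule ccontr)
    assume "\<not> 4 < t"
    then have "s < 4" if "s < t" for s using that by simp
    then have "conj_in_interval R t \<subseteq> conj_in_interval R 4" unfolding conj_in_interval_def by blast
    then show False using that fin finite_subset by (auto simp: JR_set_def)
  qed
  have "ereal (2 * real (\<nu> + x0 + 3)) \<in> JR_set R"
    using X.infinite_conj_in_interval[OF real] unfolding R_def X.tower_union_eq JR_set_def by simp
  then have "JR_number R \<le> ereal (2 * real (\<nu> + x0 + 3))" unfolding JR_number_def by (rule Inf_lower)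
  then have "JR_number R < \<infinity>" by (rule le_less_trans) simp
  moreover have "4 \<le> JR_number R" unfolding JR_number_def using gt by (intro Inf_greatest less_imp_le)
  moreover have "\<not> JR_is_minimum R" if "JR_number R = 4" using gt that unfolding JR_is_minimum_def by auto
  ultimately show ?thesis unfolding R_def[symmetric] by (auto simp: order_le_less)
qed

end
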